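(* Let $R$ be a large ideal domain (LID), let $(\Omega,\mu)$ be a probability space, let $(T_g)_{g\in\mathcal{A}_R}$ be a measure preserving action of $\mathcal{A}_R$ on $\Omega$, let $B\subset\Omega$ be a measurable set and let $\epsilon>0$. Then the set $$\Big\{u\in R\setminus\{0\}:\ \mu\big(T_{A_u}^{-1}B\cap T_{M_u}^{-1}B\big)\ge\mu(B)^2-\epsilon\Big\}$$ is $DC^*$ and, in particular, affinely syndetic in $R$.
   Context: A ring $R$ is a large ideal domain (LID) if it is an infinite countable integral domain (commutative with $1$) such that for every $x\in R\setminus\{0\}$ the ideal $xR$ has finite index in $R$ as an additive subgroup. Write $R^*=R\setminus\{0\}$. The affine semigroup $\mathcal{A}_R$ is the semigroup under composition of all maps $R\to R$, $x\mapsto ux+v$, with $u\in R^*$, $v\in R$; $A_v:x\mapsto x+v$ ($v\in R$), $M_u:x\mapsto ux$ ($u\in R^*$). A measure preserving action consists of measurable maps $T_g:\Omega\to\Omega$ with $T_gT_h=T_{gh}$ and $\mu(T_g^{-1}C)=\mu(C)$ for all measurable $C$. A set $S\subset R$ is affinely syndetic if there is a finite $F\subset\mathcal{A}_R$ such that for every $x\in R$ there is $g\in F$ with $g(x)\in S$. Ultrafilters: $\beta R$ is the set of ultrafilters on $R$ with the compact Hausdorff topology generated by the sets $\overline{E}=\{p\in\beta R:E\in p\}$, $E\subset R$; $\beta(R^* )=\{p\in\beta R: R^*\in p\}$. For $p,q\in\beta R$: $E\in p+q\iff\{u\in R:\{x\in R:x+u\in E\}\in q\}\in p$, and $E\in pq\iff\{u\in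 R:\{x\in R:ux\in E\}\in q\}\in p$. Elements of $R$ are identified with principal ultrafilters. A set $Y\subset\beta R$ is $S_A$-invariant if $u+p\in Y$ for all $p\in Y,u\in R$; $Y\subset\beta(R^* )$ is $S_M$-invariant if $up\in Y$ for all $p\in Y,u\in R^*$. $\mathcal{AMI}$ is the set of non-principal $p\in\beta R$ with $p+p=p$ that belong to a minimal nonempty compact $S_A$-invariant subset of $\beta R$; $\mathcal{MMI}$ is the set of non-principal $p\in\beta(R^* )$ with $pp=p$ that belong to a minimal nonempty compact $S_M$-invariant subset of $\beta(R^* )$. $\mathcal{G}=\overline{\mathcal{AMI}}\cap\mathcal{MMI}$ (closure in $\beta R$). A set $C\subset R$ is $DC$ if $C\in p$ for some $p\in\mathcal{G}$, and $DC^*$ if it has nonempty intersection with every $DC$ set (equivalently, $C\in p$ for all $p\in\mathcal{G}$). *)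

theory Defs
  imports "HOL-Probability.Probability"
begin

text \<open>The ring is the type \<open>'a\<close> itself; the classes used supply commutativity, \<open>1 \<noteq> 0\<close> and the
  absence of zero divisors. In the finite-index condition, \<open>(+) r ` range ((*) x)\<close> is the
  additive coset \<open>r + xR\<close>.\<close>

definition large_ideal_domain :: "'a::idom itself \<Rightarrow> bool" where
  "large_ideal_domain _ \<longleftrightarrow>
     infinite (UNIV :: 'a set) \<and> countable (UNIV :: 'a set) \<and>
     (\<forall>x::'a. x \<noteq> 0 \<longrightarrow> finite (range (\<lambda>r. (+) r ` range ((*) x))))"

definition add_map :: "'a::idom \<Rightarrow> 'a \<Rightarrow> 'a" where
  "add_map v = (\<lambda>x. x + v)"

definition mult_map :: "'a::idom \<Rightarrow> 'a \<Rightarrow> 'a" where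
  "mult_map u = (\<lambda>x. u * x)"

definition affine_semigroup :: "('a::idom \<Rightarrow> 'a) set" where
  "affine_semigroup = {(\<lambda>x. u * x + v) | u v. u \<noteq> 0}"

definition affinely_syndetic :: "'a::idom set \<Rightarrow> bool" where
  "affinely_syndetic S \<longleftrightarrow>
     (\<exists>F. finite F \<and> F \<subseteq> affine_semigroup \<and> (\<forall>x. \<exists>g\<in>F. g x \<in> S))"

text \<open>A semigroup action: the identity map is not required to act as the identity.\<close>

definition measure_preserving_action ::
    "'w measure \<Rightarrow> (('a::idom \<Rightarrow> 'a) \<Rightarrow> 'w \<Rightarrow> 'w) \<Rightarrow> bool" where
  "measure_preserving_action \<mu> T \<longleftrightarrow>
     (\<forall>g\<in>affine_semigroup. T g \<in> measurable \<mu> \<mu>) \<and>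
     (\<forall>g\<in>affine_semigroup. \<forall>h\<in>affine_semigroup. \<forall>\<omega>\<in>space \<mu>. T g (T h \<omega>) = T (g \<circ> h) \<omega>) \<and>
     (\<forall>g\<in>affine_semigroup. \<forall>C\<in>sets \<mu>. emeasure \<mu> (T g -` C \<inter> space \<mu>) = emeasure \<mu> C)"

text \<open>Ultrafilters are library filters, with \<open>E \<in> p\<close> rendered as \<open>eventually (\<lambda>x. x \<in> E) p\<close>. The
  principal ultrafilter at \<open>u\<close> is \<open>principal {u}\<close>.\<close>

definition ultrafilter :: "'a filter \<Rightarrow> bool" where
  "ultrafilter p \<longleftrightarrow>
     p \<noteq> bot \<and> (\<forall>E. eventually (\<lambda>x. x \<in> E) p \<or> eventually (\<lambda>x. x \<in> - E) p)"

definition nonprincipal :: "'a filter \<Rightarrow> bool" where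
  "nonprincipal p \<longleftrightarrow> (\<forall>u. p \<noteq> principal {u})"

definition beta_topology :: "'a filter topology" where
  "beta_topology =
     topology_generated_by (range (\<lambda>E. {p. ultrafilter p \<and> eventually (\<lambda>x. x \<in> E) p}))"

lemma topspace_beta_topology: "topspace beta_topology = {p. ultrafilter p}"
proof -
  have "{p :: 'a filter. ultrafilter p} =
      {p. ultrafilter p \<and> eventually (\<lambda>x. x \<in> (UNIV :: 'a set)) p}"
    by simp
  then show ?thesis
    unfolding beta_topology_def topology_generated_by_topspace by blast
qed

definition beta_star :: "'a::idom filter set" where
  "beta_star = {p. ultrafilter p \<and> eventually (\<lambda>x. x \<in> UNIV - {0}) p}"

definition ultra_add :: "'a::idom filter \<Rightarrow> 'a filter \<Rightarrow> 'a filter" where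
  "ultra_add p q = Abs_filter (\<lambda>P. \<forall>\<^sub>F u in p. \<forall>\<^sub>F x in q. P (x + u))"

definition ultra_mult :: "'a::idom filter \<Rightarrow> 'a filter \<Rightarrow> 'a filter" where
  "ultra_mult p q = Abs_filter (\<lambda>P. \<forall>\<^sub>F u in p. \<forall>\<^sub>F x in q. P (u * x))"

lemma eventually_ultra_add:
  "eventually P (ultra_add p q) \<longleftrightarrow> (\<forall>\<^sub>F u in p. \<forall>\<^sub>F x in q. P (x + u))"
  unfolding ultra_add_def
  by (subst eventually_Abs_filter)
    (auto simp: is_filter_def eventually_conj_iff elim!: eventually_mono)

lemma eventually_ultra_mult:
  "eventually P (ultra_mult p q) \<longleftrightarrow> (\<forall>\<^sub>F u in p. \<forall>\<^sub>F x in q. P (u * x))"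
  unfolding ultra_mult_def
  by (subst eventually_Abs_filter)
    (auto simp: is_filter_def eventually_conj_iff elim!: eventually_mono)

definition SA_invariant :: "'a::idom filter set \<Rightarrow> bool" where
  "SA_invariant Y \<longleftrightarrow> (\<forall>p\<in>Y. \<forall>u. ultra_add (principal {u}) p \<in> Y)"

definition SM_invariant :: "'a::idom filter set \<Rightarrow> bool" where
  "SM_invariant Y \<longleftrightarrow> (\<forall>p\<in>Y. \<forall>u. u \<noteq> 0 \<longrightarrow> ultra_mult (principal {u}) p \<in> Y)"

text \<open>Compactness in \<open>beta_topology\<close> includes being a set of ultrafilters.\<close>

definition compact_SA_invariant :: "'a::idom filter set \<Rightarrow> bool" where
  "compact_SA_invariant Y \<longleftrightarrow> Y \<noteq> {} \<and> compactin beta_topology Y \<and> SA_invariant Y"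

definition compact_SM_invariant :: "'a::idom filter set \<Rightarrow> bool" where
  "compact_SM_invariant Y \<longleftrightarrow>
     Y \<noteq> {} \<and> Y \<subseteq> beta_star \<and> compactin beta_topology Y \<and> SM_invariant Y"

definition AMI :: "'a::idom filter set" where
  "AMI = {p. ultrafilter p \<and> nonprincipal p \<and> ultra_add p p = p \<and>
     (\<exists>Y. compact_SA_invariant Y \<and> (\<forall>Z. compact_SA_invariant Z \<and> Z \<subseteq> Y \<longrightarrow> Z = Y) \<and> p \<in> Y)}"

definition MMI :: "'a::idom filter set" where
  "MMI = {p \<in> beta_star. nonprincipal p \<and> ultra_mult p p = p \<and>
     (\<exists>Y. compact_SM_invariant Y \<and> (\<forall>Z. compact_SM_invariant Z \<and> Z \<subseteq> Y \<longrightarrow> Z = Y) \<and> p \<in> Y)}"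

definition DC_ultrafilters :: "'a::idom filter set" where
  "DC_ultrafilters = (beta_topology closure_of AMI) \<inter> MMI"

definition DC :: "'a::idom set \<Rightarrow> bool" where
  "DC C \<longleftrightarrow> (\<exists>p\<in>DC_ultrafilters. eventually (\<lambda>x. x \<in> C) p)"

definition DC_star :: "'a::idom set \<Rightarrow> bool" where
  "DC_star C \<longleftrightarrow> (\<forall>D. DC D \<longrightarrow> C \<inter> D \<noteq> {})"

lemma DC_star_iff:
  "DC_star C \<longleftrightarrow> (\<forall>p\<in>DC_ultrafilters. eventually (\<lambda>x. x \<in> C) p)"
proof
  assume C: "DC_star C"
  show "\<forall>p\<in>DC_ultrafilters. eventually (\<lambda>x. x \<in> C) p"
  proof
    fix p :: "'a filter"
    assume p: "p \<in> DC_ultrafilters"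
    then have "ultrafilter p"
      by (simp add: DC_ultrafilters_def MMI_def beta_star_def)
    moreover have "\<not> eventually (\<lambda>x. x \<in> - C) p"
      using C p unfolding DC_star_def DC_def by (metis Compl_disjoint)
    ultimately show "eventually (\<lambda>x. x \<in> C) p"
      unfolding ultrafilter_def by blast
  qed
next
  assume R: "\<forall>p\<in>DC_ultrafilters. eventually (\<lambda>x. x \<in> C) p"
  show "DC_star C"
    unfolding DC_star_def
  proof (intro allI impI notI)
    fix D
    assume "DC D" and CD: "C \<inter> D = {}"
    then obtain p where p: "p \<in> DC_ultrafilters" "eventually (\<lambda>x. x \<in> D) p"
      unfolding DC_def by blast
    with R have "eventually (\<lambda>x. x \<in> C \<and> x \<in> D) p"
      by (simp add: eventually_conj_iff)
    moreover have "(\<lambda>x. x \<in> C \<and> x \<in> D) = (\<lambda>_. False)"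
      using CD by auto
    ultimately have "p = bot"
      by (simp add: trivial_limit_def)
    then show False
      using p by (simp add: DC_ultrafilters_def MMI_def beta_star_def ultrafilter_def)
  qed
qed

end

theory Submission
  imports Defs "HOL-Library.Function_Algebras"
begin

text \<open>Write \<open>A\<^sub>u f = f \<circ> T (add_map u)\<close> and \<open>M\<^sub>u f = f \<circ> T (mult_map u)\<close>, isometries of \<open>L\<^sup>2\<close> with
  \<open>A\<^sub>v M\<^sub>u = M\<^sub>u A\<^bsub>uv\<^esub>\<close>, and let \<open>f\<close> be the indicator of \<open>B\<close>. The limit of \<open>A\<^sub>u\<close> along a minimal additive
  idempotent is a projection \<open>V\<close>. It is the same for all such idempotents, since the limit operators
  commute and minimal ideals absorb idempotents; and it is unchanged if \<open>A\<^sub>u\<close> is replaced by \<open>A\<^bsub>cu\<^esub>\<close>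
  with \<open>c \<noteq> 0\<close>, since \<open>cR\<close> has finite index. Hence the limits of \<open>A\<^bsub>cu\<^esub>\<close> along a DC ultrafilter \<open>p\<close> are
  also \<open>V\<close>. On the complement, \<open>h = f - V f\<close>, a van der Corput argument for the multiplicative
  idempotent \<open>p\<close> gives that the inner product of \<open>A\<^sub>u h\<close> and \<open>M\<^sub>u f\<close> tends to \<open>0\<close>, because
  the inner products of \<open>M\<^sub>b A\<^sub>a h\<close> and \<open>A\<^bsub>ab\<^esub> h\<close> equal those of \<open>M\<^sub>b A\<^bsub>(1 - b\<^sup>2)a\<^esub> h\<close> and \<open>h\<close>. The remaining term
  is the limit of the inner products of \<open>V f\<close> and \<open>M\<^sub>u V f\<close>, which is at least the squared mean of
  \<open>f\<close> by positive definiteness.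

  For syndeticity, were \<open>S\<close> not affinely syndetic, the ultrafilters all of whose affine images
  contain the complement of \<open>S\<close> would form a nonempty closed set invariant under both operations.
  Such a set contains a DC ultrafilter.\<close>

section \<open>Ultrafilters and the Stone space\<close>

lemma ultrafilter_not_bot: "ultrafilter p \<Longrightarrow> p \<noteq> bot"
  by (simp add: ultrafilter_def)

lemma ultrafilter_eventually_cases:
  assumes "ultrafilter p"
  shows "eventually P p \<or> eventually (\<lambda>x. \<not> P x) p"
  using assms unfolding ultrafilter_def by (auto dest: spec[of _ "Collect P"])

lemma ultrafilter_eventually_not:
  assumes "ultrafilter p"
  shows "eventually (\<lambda>x. \<not> P x) p \<longleftrightarrow> \<not> eventually P p"
proof
  assume *: "eventually (\<lambda>x. \<not> P x) p"
  show "\<not> eventually P p"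
  proof
    assume "eventually P p"
    with * have "eventually (\<lambda>x. False) p"
      by eventually_elim simp
    then show False
      using ultrafilter_not_bot[OF assms] by (simp add: trivial_limit_def)
  qed
qed (use ultrafilter_eventually_cases[OF assms] in blast)

lemma ultrafilter_eventually_disj:
  assumes "ultrafilter p" "eventually (\<lambda>x. P x \<or> Q x) p"
  shows "eventually P p \<or> eventually Q p"
proof (rule ccontr)
  assume "\<not> (eventually P p \<or> eventually Q p)"
  then have "eventually (\<lambda>x. \<not> P x) p" "eventually (\<lambda>x. \<not> Q x) p"
    by (auto simp: ultrafilter_eventually_not[OF assms(1)])
  then have "eventually (\<lambda>x. \<not> (P x \<or> Q x)) p"
    by eventually_elim auto
  then show False
    using ultrafilter_eventually_not[OF assms(1)] assms(2) by blast
qed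

lemma ultrafilter_eventually_finite_bex:
  assumes "ultrafilter p" "finite I" "eventually (\<lambda>x. \<exists>i\<in>I. P i x) p"
  shows "\<exists>i\<in>I. eventually (P i) p"
  using assms(2,3)
proof (induction I rule: finite_induct)
  case empty
  then show ?case using ultrafilter_not_bot[OF assms(1)] by (simp add: trivial_limit_def)
next
  case (insert i I)
  then have "eventually (P i) p \<or> eventually (\<lambda>x. \<exists>i\<in>I. P i x) p"
    by (intro ultrafilter_eventually_disj[OF assms(1)]) simp
  then show ?case using insert.IH by auto
qed

text \<open>A property holding along \<open>q\<close> but not along \<open>p\<close> would have its
  negation hold along \<open>p\<close>, hence along the smaller \<open>q\<close>, making
  \<open>q\<close> improper. Later equalities between ultrafilters are proved through one inclusion
  in this way.\<close>

lemma ultrafilter_le_imp_eq: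
  assumes "ultrafilter p" "q \<le> p" "q \<noteq> bot"
  shows "q = p"
proof (rule antisym[OF assms(2)])
  show "p \<le> q"
  proof (rule filter_leI, rule ccontr)
    fix P assume P: "eventually P q" "\<not> eventually P p"
    then have "eventually (\<lambda>x. \<not> P x) q"
      using assms(2) ultrafilter_eventually_not[OF assms(1)] by (auto simp: le_filter_def)
    from P(1) this have "eventually (\<lambda>x. False) q"
      by eventually_elim simp
    then show False using assms(3) by (simp add: trivial_limit_def)
  qed
qed

lemma ultrafilter_principal: "ultrafilter (principal {u})"
  by (auto simp: ultrafilter_def eventually_principal principal_eq_bot_iff)

lemma ultrafilter_filtermap:
  assumes "ultrafilter p"
  shows "ultrafilter (filtermap f p)"
  unfolding ultrafilter_def
proof (intro conjI allI)
  show "filtermap f p \<noteq> bot"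
    using assms by (simp add: filtermap_bot_iff ultrafilter_def)
  show "eventually (\<lambda>x. x \<in> E) (filtermap f p) \<or> eventually (\<lambda>x. x \<in> - E) (filtermap f p)" for E
    using ultrafilter_eventually_cases[OF assms, of "\<lambda>x. f x \<in> E"] by (simp add: eventually_filtermap)
qed

text \<open>Ultrafilters are the minimal proper filters for \<open>\<le>\<close>, so Zorn is applied to the chain of
  their sets of eventual properties.\<close>

lemma exists_ultrafilter_le:
  assumes "F \<noteq> (bot :: 'a filter)"
  obtains p where "p \<le> F" "ultrafilter p"
proof -
  define S where "S = {G. G \<le> F \<and> G \<noteq> bot}"
  define ev where "ev G = {P. eventually P G}" for G :: "'a filter"
  have ev_mono: "ev G \<subseteq> ev H \<longleftrightarrow> H \<le> G" for G H
    by (auto simp: ev_def le_filter_def)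
  have "\<exists>M\<in>ev ` S. \<forall>X\<in>ev ` S. M \<subseteq> X \<longrightarrow> X = M"
  proof (rule subset_Zorn)
    fix C assume "subset.chain (ev ` S) C"
    then obtain D where D: "D \<subseteq> S" "C = ev ` D"
      by (auto simp: subset.chain_def subset_image_iff)
    have chain: "G \<le> H \<or> H \<le> G" if "G \<in> D" "H \<in> D" for G H
      using \<open>subset.chain (ev ` S) C\<close> that unfolding D(2) subset_chain_def
      by (auto simp: ev_mono)
    show "\<exists>U\<in>ev ` S. \<forall>X\<in>C. X \<subseteq> U"
    proof (cases "D = {}")
      case True
      then show ?thesis using assms D by (auto simp: S_def)
    next
      case False
      have "eventually P (Inf D) \<longleftrightarrow> (\<exists>b\<in>D. eventually P b)" for P
        by (rule eventually_Inf_base[OF False]) (metis chain inf.absorb1 inf.absorb2 order_refl)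
      then have "Inf D \<noteq> bot"
        using D(1) by (auto simp: trivial_limit_def S_def)
      moreover have "Inf D \<le> F"
        using False D(1) by (auto simp: S_def intro: Inf_lower2)
      ultimately have "Inf D \<in> S" by (simp add: S_def)
      then show ?thesis
        unfolding D(2) by (intro bexI[of _ "ev (Inf D)"]) (auto simp: ev_mono intro: Inf_lower)
    qed
  qed
  then obtain p where p: "p \<in> S" and min: "\<And>q. q \<in> S \<Longrightarrow> q \<le> p \<Longrightarrow> ev q = ev p"
    by (auto simp: ev_mono)
  have "eventually (\<lambda>x. x \<in> E) p \<or> eventually (\<lambda>x. x \<in> - E) p" for E
  proof (rule disjCI)
    assume E: "\<not> eventually (\<lambda>x. x \<in> - E) p"
    \<comment> \<open>If \<open>- E\<close> is not large along \<open>p\<close>, refining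
      \<open>p\<close> by \<open>E\<close> keeps it proper, so minimality makes \<open>E\<close>
      large already.\<close>
    have "inf p (principal E) \<in> S"
      using p E by (auto simp: S_def trivial_limit_def eventually_inf_principal le_infI1)
    then have "ev (inf p (principal E)) = ev p"
      by (rule min) simp
    moreover have "(\<lambda>x. x \<in> E) \<in> ev (inf p (principal E))"
      by (simp add: ev_def eventually_inf_principal)
    ultimately show "eventually (\<lambda>x. x \<in> E) p"
      by (simp add: ev_def)
  qed
  then have "ultrafilter p"
    using p by (simp add: ultrafilter_def S_def)
  then show ?thesis using p that by (auto simp: S_def)
qed

section \<open>Open, closed and compact sets of the Stone space\<close>

lemma openin_beta_basic: "openin beta_topology {p. ultrafilter p \<and> eventually (\<lambda>x. x \<in> E) p}"
  unfolding beta_topology_def by (rule topology_generated_by_Basis) blast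

text \<open>The generating sets are closed under finite intersections, so they form a base and not
  merely a subbase.\<close>

lemma openin_beta_nhd:
  assumes "openin beta_topology U" "p \<in> U"
  shows "\<exists>E. eventually (\<lambda>x. x \<in> E) p \<and> {q. ultrafilter q \<and> eventually (\<lambda>x. x \<in> E) q} \<subseteq> U"
proof -
  have "generate_topology_on (range (\<lambda>E. {p. ultrafilter p \<and> eventually (\<lambda>x. x \<in> E) p})) U"
    using assms(1) by (simp add: beta_topology_def openin_topology_generated_by_iff)
  then show ?thesis
    using assms(2)
  proof (induction U rule: generate_topology_on.induct)
    case (Int a b)
    then obtain E E' where
      "eventually (\<lambda>x. x \<in> E) p" "{q. ultrafilter q \<and> eventually (\<lambda>x. x \<in> E) q} \<subseteq> a"
      "eventually (\<lambda>x. x \<in> E') p" "{q. ultrafilter q \<and> eventually (\<lambda>x. x \<in> E') q} \<subseteq> b"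
      by auto
    then show ?case
      by (intro exI[of _ "E \<inter> E'"]) (auto simp: eventually_conj_iff)
  next
    case (UN K)
    then obtain k where "k \<in> K" "p \<in> k" by auto
    with UN.IH[OF this] show ?case by (meson Sup_upper subset_trans)
  qed auto
qed

text \<open>The closed sets of the Stone space are the sets of ultrafilters below a fixed filter.\<close>

definition ultra_closed :: "'a filter set \<Rightarrow> bool" where
  "ultra_closed Y \<longleftrightarrow> (\<forall>p\<in>Y. ultrafilter p) \<and> (\<forall>p. ultrafilter p \<longrightarrow> p \<le> Sup Y \<longrightarrow> p \<in> Y)"

lemma ultra_closedI:
  "(\<And>p. p \<in> Y \<Longrightarrow> ultrafilter p) \<Longrightarrow> (\<And>p. ultrafilter p \<Longrightarrow> p \<le> Sup Y \<Longrightarrow> p \<in> Y) \<Longrightarrow> ultra_closed Y"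
  by (simp add: ultra_closed_def)

lemma ultra_closed_ultrafilter: "ultra_closed Y \<Longrightarrow> p \<in> Y \<Longrightarrow> ultrafilter p"
  by (simp add: ultra_closed_def)

lemma ultra_closed_below: "ultra_closed {p. ultrafilter p \<and> p \<le> F}"
proof (rule ultra_closedI)
  fix p assume "ultrafilter p" "p \<le> Sup {p. ultrafilter p \<and> p \<le> F}"
  moreover have "Sup {p. ultrafilter p \<and> p \<le> F} \<le> F" by (rule Sup_least) simp
  ultimately show "p \<in> {p. ultrafilter p \<and> p \<le> F}" by auto
qed simp

lemma ultra_closed_Inter:
  assumes "\<And>Y. Y \<in> C \<Longrightarrow> ultra_closed Y" "C \<noteq> {}"
  shows "ultra_closed (\<Inter>C)"
proof (rule ultra_closedI)
  fix p assume "p \<in> \<Inter>C" then show "ultrafilter p"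
    using assms by (auto simp: ultra_closed_def)
next
  fix p assume p: "ultrafilter p" "p \<le> Sup (\<Inter>C)"
  have "p \<in> Y" if "Y \<in> C" for Y
  proof -
    have "Sup (\<Inter>C) \<le> Sup Y" using that by (intro Sup_subset_mono) auto
    then show ?thesis using p assms(1)[OF that] by (auto simp: ultra_closed_def)
  qed
  then show "p \<in> \<Inter>C" by blast
qed

text \<open>The Hausdorff property and compactness of the Stone space in filter form. A point
  outside a compact \<open>Y\<close> is separated from each member of \<open>Y\<close> by a set, and
  finitely many of these sets already cover \<open>Y\<close>. Conversely, an ultrafilter below
  \<open>Sup Y\<close> that avoids a whole cover would be an uncovered point of
  \<open>Y\<close>.\<close>

lemma compactin_beta_iff: "compactin beta_topology Y \<longleftrightarrow> ultra_closed Y"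
proof
  assume Y: "compactin beta_topology Y"
  show "ultra_closed Y"
  proof (rule ultra_closedI)
    show uf: "ultrafilter p" if "p \<in> Y" for p
      using Y that by (auto simp: compactin_def topspace_beta_topology)
    fix p assume p: "ultrafilter p" "p \<le> Sup Y"
    show "p \<in> Y"
    proof (rule ccontr)
      assume "p \<notin> Y"
      have "\<exists>E. eventually (\<lambda>x. x \<in> E) y \<and> \<not> eventually (\<lambda>x. x \<in> E) p" if "y \<in> Y" for y
      proof (rule ccontr)
        assume *: "\<not> ?thesis"
        have "p \<le> y"
        proof (rule filter_leI)
          fix P assume "eventually P y"
          then show "eventually P p"
            using * by (auto dest: spec[of _ "Collect P"])
        qed
        then have "p = y" using p uf[OF that] by (intro ultrafilter_le_imp_eq ultrafilter_not_bot)
        with \<open>p \<notin> Y\<close> that show False by simp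
      qed
      then obtain E where E: "\<And>y. y \<in> Y \<Longrightarrow> eventually (\<lambda>x. x \<in> E y) y"
          "\<And>y. y \<in> Y \<Longrightarrow> \<not> eventually (\<lambda>x. x \<in> E y) p"
        by metis
      define U where "U y = {q. ultrafilter q \<and> eventually (\<lambda>x. x \<in> E y) q}" for y
      have "Y \<subseteq> \<Union>(U ` Y)" using E uf by (auto simp: U_def)
      moreover have "\<forall>V\<in>U ` Y. openin beta_topology V" by (auto simp: U_def openin_beta_basic)
      ultimately obtain \<F> where "finite \<F>" "\<F> \<subseteq> U ` Y" "Y \<subseteq> \<Union>\<F>"
        using Y unfolding compactin_def by meson
      then obtain Z where Z: "finite Z" "Z \<subseteq> Y" "Y \<subseteq> \<Union>(U ` Z)"
        by (metis finite_subset_image)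
      have "eventually (\<lambda>x. \<exists>z\<in>Z. x \<in> E z) y" if "y \<in> Y" for y
      proof -
        obtain z where "z \<in> Z" "eventually (\<lambda>x. x \<in> E z) y"
          using Z(3) \<open>y \<in> Y\<close> by (auto simp: U_def)
        then show ?thesis by (auto elim: eventually_mono)
      qed
      then have "eventually (\<lambda>x. \<exists>z\<in>Z. x \<in> E z) p"
        using p(2) by (auto simp: le_filter_def eventually_Sup)
      then show False
        using ultrafilter_eventually_finite_bex[OF p(1) Z(1), of "\<lambda>z x. x \<in> E z"] E(2) Z(2) by blast
    qed
  qed
next
  assume Y: "ultra_closed Y"
  show "compactin beta_topology Y"
    unfolding compactin_def
  proof (intro conjI allI impI)
    show "Y \<subseteq> topspace beta_topology"
      using Y by (auto simp: topspace_beta_topology ultra_closed_def)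
    fix \<U> assume U: "(\<forall>U\<in>\<U>. openin beta_topology U) \<and> Y \<subseteq> \<Union>\<U>"
    define \<E> where "\<E> = {E. \<exists>U\<in>\<U>. {q. ultrafilter q \<and> eventually (\<lambda>x. x \<in> E) q} \<subseteq> U}"
    have cover: "\<exists>E\<in>\<E>. eventually (\<lambda>x. x \<in> E) p" if "p \<in> Y" for p
    proof -
      obtain V where "V \<in> \<U>" "p \<in> V" using U \<open>p \<in> Y\<close> by blast
      then show ?thesis using openin_beta_nhd[of V p] U by (auto simp: \<E>_def)
    qed
    \<comment> \<open>\<open>F\<close> adds to \<open>Sup Y\<close> the complements of all sets from
      the cover. An ultrafilter below it would be an uncovered point of \<open>Y\<close>, so
      \<open>F\<close> is improper. This is witnessed by finitely many complements, which give the
      finite subcover.\<close>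
    define F where "F = inf (Sup Y) (INF E\<in>\<E>. principal (- E))"
    have "F = bot"
    proof (rule ccontr)
      assume "F \<noteq> bot"
      then obtain p where p: "p \<le> F" "ultrafilter p" by (rule exists_ultrafilter_le)
      then have "p \<in> Y" using Y by (auto simp: F_def ultra_closed_def)
      then obtain E where E: "E \<in> \<E>" "eventually (\<lambda>x. x \<in> E) p" using cover by blast
      have "F \<le> principal (- E)"
        unfolding F_def by (rule le_infI2, rule INF_lower, rule E(1))
      with p(1) have "p \<le> principal (- E)" by (rule order_trans)
      then have "eventually (\<lambda>x. \<not> x \<in> E) p"
        by (auto simp: le_filter_def eventually_principal)
      then show False using E(2) ultrafilter_eventually_not[OF p(2)] by blast
    qed
    then have "eventually (\<lambda>x. False) (inf (Sup Y) (INF E\<in>\<E>. principal (- E)))"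
      by (simp add: F_def)
    then obtain P Q where P: "eventually P (Sup Y)"
      and Q: "eventually Q (INF E\<in>\<E>. principal (- E))" and PQ: "\<And>x. P x \<Longrightarrow> Q x \<Longrightarrow> False"
      unfolding eventually_inf by auto
    from Q obtain X where X: "X \<subseteq> \<E>" "finite X" "eventually Q (INF E\<in>X. principal (- E))"
      unfolding eventually_INF[of _ _ \<E>] by blast
    have Q': "Q x" if "\<forall>E\<in>X. x \<notin> E" for x
      using X(2,3) that by (simp add: INF_principal_finite eventually_principal)
    have "\<forall>E\<in>X. \<exists>V. V \<in> \<U> \<and> {q. ultrafilter q \<and> eventually (\<lambda>x. x \<in> E) q} \<subseteq> V"
      using X(1) unfolding \<E>_def by blast
    then obtain W where W: "\<And>E. E \<in> X \<Longrightarrow> W E \<in> \<U> \<and>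
        {q. ultrafilter q \<and> eventually (\<lambda>x. x \<in> E) q} \<subseteq> W E"
      unfolding bchoice_iff by blast
    have "Y \<subseteq> \<Union>(W ` X)"
    proof
      fix p assume p: "p \<in> Y"
      then have uf: "ultrafilter p" using Y by (simp add: ultra_closed_def)
      have "eventually P p" using P p by (simp add: eventually_Sup)
      then have "eventually (\<lambda>x. \<exists>E\<in>X. x \<in> E) p"
        by eventually_elim (use PQ Q' in blast)
      then obtain E where "E \<in> X" "eventually (\<lambda>x. x \<in> E) p"
        using ultrafilter_eventually_finite_bex[OF uf X(2), of "\<lambda>E x. x \<in> E"] by blast
      then show "p \<in> \<Union>(W ` X)" using W uf by blast
    qed
    then show "\<exists>\<F>. finite \<F> \<and> \<F> \<subseteq> \<U> \<and> Y \<subseteq> \<Union>\<F>"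
      using X(2) W by (intro exI[of _ "W ` X"]) auto
  qed
qed

text \<open>The basic neighbourhood given by \<open>E\<close> misses \<open>S\<close> exactly when
  \<open>- E\<close> is large along every member of \<open>S\<close>, that is, along
  \<open>Sup S\<close>.\<close>

lemma in_beta_closure_iff:
  assumes "\<And>p. p \<in> S \<Longrightarrow> ultrafilter p"
  shows "p \<in> beta_topology closure_of S \<longleftrightarrow> ultrafilter p \<and> p \<le> Sup S"
proof
  assume p: "p \<in> beta_topology closure_of S"
  then have uf: "ultrafilter p" by (simp add: in_closure_of topspace_beta_topology)
  have nhd: "\<exists>y. y \<in> S \<and> y \<in> T" if "p \<in> T" "openin beta_topology T" for T
    using p that by (simp add: in_closure_of)
  have "p \<le> Sup S"
  proof (rule filter_leI, rule ccontr)
    fix P assume P: "eventually P (Sup S)" "\<not> eventually P p"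
    then have "eventually (\<lambda>x. x \<in> {x. \<not> P x}) p"
      using ultrafilter_eventually_not[OF uf, of P] by simp
    then have "p \<in> {q. ultrafilter q \<and> eventually (\<lambda>x. x \<in> {x. \<not> P x}) q}" using uf by simp
    from this openin_beta_basic have
      "\<exists>y. y \<in> S \<and> y \<in> {q. ultrafilter q \<and> eventually (\<lambda>x. x \<in> {x. \<not> P x}) q}"
      by (rule nhd)
    then obtain q where q: "q \<in> S"
        "q \<in> {q. ultrafilter q \<and> eventually (\<lambda>x. x \<in> {x. \<not> P x}) q}" by blast
    from P(1) q(1) have "eventually P q" by (simp add: eventually_Sup)
    with q(2) show False
      using ultrafilter_eventually_not[of q P] by simp
  qed
  with uf show "ultrafilter p \<and> p \<le> Sup S" by simp
next
  assume p: "ultrafilter p \<and> p \<le> Sup S"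
  show "p \<in> beta_topology closure_of S"
    unfolding in_closure_of topspace_beta_topology
  proof (intro conjI allI impI)
    fix T assume "p \<in> T \<and> openin beta_topology T"
    then obtain E where E: "eventually (\<lambda>x. x \<in> E) p"
        "{q. ultrafilter q \<and> eventually (\<lambda>x. x \<in> E) q} \<subseteq> T"
      using openin_beta_nhd by blast
    have "\<not> eventually (\<lambda>x. x \<notin> E) p"
      using p E(1) ultrafilter_eventually_not by blast
    then have "\<not> eventually (\<lambda>x. x \<notin> E) (Sup S)"
      using p by (meson filter_leD)
    then obtain q where q: "q \<in> S" "\<not> eventually (\<lambda>x. x \<notin> E) q"
      unfolding eventually_Sup by blast
    then have "eventually (\<lambda>x. x \<in> E) q" "ultrafilter q"
      using assms ultrafilter_eventually_cases[of q "\<lambda>x. x \<in> E"] by auto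
    then show "\<exists>y. y \<in> S \<and> y \<in> T"
      using E(2) q(1) by blast
  qed (use p in simp)
qed

text \<open>Zorn's lemma, applied to complements because a minimal set is wanted. The predicate
  \<open>\<Phi>\<close> is kept abstract: it becomes invariance in \<open>exists_minimal\<close> and
  closure under products in \<open>Ellis_idempotent\<close>.\<close>

lemma exists_minimal_ultra_closed:
  fixes \<Phi> :: "'a filter set \<Rightarrow> bool"
  assumes Y: "ultra_closed Y" "Y \<noteq> {}" "\<Phi> Y"
    and Int: "\<And>C. C \<noteq> {} \<Longrightarrow> (\<And>Z. Z \<in> C \<Longrightarrow> ultra_closed Z \<and> \<Phi> Z) \<Longrightarrow> \<Phi> (\<Inter>C)"
  obtains M where "M \<subseteq> Y" "ultra_closed M" "M \<noteq> {}" "\<Phi> M"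
    "\<And>Z. Z \<subseteq> M \<Longrightarrow> ultra_closed Z \<Longrightarrow> Z \<noteq> {} \<Longrightarrow> \<Phi> Z \<Longrightarrow> Z = M"
proof -
  define S where "S = {Z. Z \<subseteq> Y \<and> ultra_closed Z \<and> Z \<noteq> {} \<and> \<Phi> Z}"
  have "\<exists>M\<in>uminus ` S. \<forall>X\<in>uminus ` S. M \<subseteq> X \<longrightarrow> X = M"
  proof (rule subset_Zorn)
    fix C assume C: "subset.chain (uminus ` S) C"
    then obtain D where D: "D \<subseteq> S" "C = uminus ` D"
      by (auto simp: subset.chain_def subset_image_iff)
    have chain: "G \<subseteq> H \<or> H \<subseteq> G" if "G \<in> D" "H \<in> D" for G H
    proof -
      have "\<forall>X\<in>C. \<forall>Z\<in>C. X \<subseteq> Z \<or> Z \<subseteq> X"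
        using C by (simp add: subset_chain_def)
      then have "- G \<subseteq> - H \<or> - H \<subseteq> - G"
        unfolding D(2) using that by (metis imageI)
      then show ?thesis by (simp only: Compl_subset_Compl_iff disj_commute)
    qed
    show "\<exists>U\<in>uminus ` S. \<forall>X\<in>C. X \<subseteq> U"
    proof (cases "D = {}")
      case True
      then have "C = {}" "Y \<in> S" using Y D by (simp_all add: S_def)
      then show ?thesis by blast
    next
      case False
      have ne: "G \<noteq> {}" "ultra_closed G" "\<Phi> G" "G \<subseteq> Y" if "G \<in> D" for G
        using D(1) that by (auto simp: S_def)
      \<comment> \<open>Compactness along the chain: the filters \<open>Sup G\<close> are directed
        and proper, so some ultrafilter lies below all of them and hence in every
        \<open>G\<close>.\<close>
      define F where "F = (INF G\<in>D. Sup G)"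
      have "eventually P F \<longleftrightarrow> (\<exists>G\<in>D. eventually P (Sup G))" for P
        unfolding F_def
      proof (rule eventually_INF_base[OF False])
        fix G H assume "G \<in> D" "H \<in> D"
        with chain[OF this] show "\<exists>x\<in>D. Sup x \<le> inf (Sup G) (Sup H)"
          by (metis Sup_subset_mono inf.boundedI order_refl)
      qed
      moreover have "\<not> eventually (\<lambda>x. False) (Sup G)" if G: "G \<in> D" for G
      proof -
        obtain q where "q \<in> G" using ne(1)[OF G] by blast
        then have "\<not> eventually (\<lambda>x. False) q"
          using ne(2)[OF G] ultrafilter_not_bot[of q] by (simp add: ultra_closed_def trivial_limit_def)
        then show ?thesis using \<open>q \<in> G\<close> unfolding eventually_Sup by blast
      qed
      ultimately have "F \<noteq> bot" unfolding trivial_limit_def by blast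
      then obtain p where p: "p \<le> F" "ultrafilter p" by (rule exists_ultrafilter_le)
      have "p \<in> G" if "G \<in> D" for G
        using p ne(2)[OF that] order_trans[OF _ INF_lower[OF that, of Sup], of p]
        by (simp add: F_def ultra_closed_def)
      then have "\<Inter>D \<noteq> {}" by blast
      moreover have "ultra_closed (\<Inter>D)" using ne(2) False by (rule ultra_closed_Inter)
      moreover have "\<Phi> (\<Inter>D)" using False by (rule Int) (use ne in simp)
      moreover have "\<Inter>D \<subseteq> Y" using False ne(4) by blast
      ultimately have "\<Inter>D \<in> S" unfolding S_def by simp
      show ?thesis unfolding D(2)
      proof (intro bexI ballI)
        show "- \<Inter>D \<in> uminus ` S" by (rule imageI) fact
        fix X assume "X \<in> uminus ` D" then show "X \<subseteq> - \<Inter>D" by auto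
      qed
    qed
  qed
  then obtain M where M: "M \<in> S" "\<forall>X\<in>uminus ` S. - M \<subseteq> X \<longrightarrow> X = - M"
    by blast
  show ?thesis
  proof (rule that[of M])
    fix Z assume "Z \<subseteq> M" "ultra_closed Z" "Z \<noteq> {}" "\<Phi> Z"
    then have "- Z \<in> uminus ` S" "- M \<subseteq> - Z"
      using M(1) by (simp_all add: S_def) (blast)
    then have "- Z = - M" using M(2) by blast
    then show "Z = M" by simp
  qed (use M(1) in \<open>simp_all add: S_def\<close>)
qed

section \<open>Products of ultrafilters\<close>

text \<open>The common form of \<open>ultra_add\<close> and \<open>ultra_mult\<close>, so that
  minimal sets and idempotents are treated once for both operations.\<close>

definition ultra_op :: "('a \<Rightarrow> 'a \<Rightarrow> 'a) \<Rightarrow> 'a filter \<Rightarrow> 'a filter \<Rightarrow> 'a filter" where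
  "ultra_op f p q = Abs_filter (\<lambda>P. \<forall>\<^sub>F u in p. \<forall>\<^sub>F x in q. P (f u x))"

lemma eventually_ultra_op:
  "eventually P (ultra_op f p q) \<longleftrightarrow> (\<forall>\<^sub>F u in p. \<forall>\<^sub>F x in q. P (f u x))"
  unfolding ultra_op_def
  by (subst eventually_Abs_filter)
    (auto simp: is_filter_def eventually_conj_iff elim!: eventually_mono)

lemma ultra_add_eq_op: "ultra_add = ultra_op (\<lambda>u x. x + u)"
  by (intro ext) (simp add: ultra_add_def ultra_op_def)

lemma ultra_mult_eq_op: "ultra_mult = ultra_op (*)"
  by (intro ext) (simp add: ultra_mult_def ultra_op_def)

lemma ultra_op_principal: "ultra_op f (principal {u}) q = filtermap (f u) q"
  by (simp add: filter_eq_iff eventually_ultra_op eventually_filtermap eventually_principal)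

lemma ultra_op_mono: "p \<le> p' \<Longrightarrow> ultra_op f p q \<le> ultra_op f p' q"
  by (simp add: le_filter_def eventually_ultra_op)

lemma ultrafilter_ultra_op:
  assumes "ultrafilter p" "ultrafilter q"
  shows "ultrafilter (ultra_op f p q)"
proof -
  have "\<not> eventually (\<lambda>x. False) (ultra_op f p q)"
    using assms by (simp add: eventually_ultra_op trivial_limit_def ultrafilter_def)
  moreover have "eventually (\<lambda>x. x \<in> E) (ultra_op f p q) \<or> eventually (\<lambda>x. x \<in> - E) (ultra_op f p q)"
    for E
    using ultrafilter_eventually_cases[OF assms(1), of "\<lambda>u. \<forall>\<^sub>F x in q. f u x \<in> E"]
    by (simp add: eventually_ultra_op ultrafilter_eventually_not[OF assms(2), of "\<lambda>x. f _ x \<in> E"])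
  ultimately show ?thesis
    by (simp add: ultrafilter_def trivial_limit_def)
qed

text \<open>The map sending \<open>r\<close> to \<open>ultra_op f r p\<close> is continuous, so the
  image of the compact set of ultrafilters below \<open>F\<close> is closed and exhausts the
  ultrafilters below \<open>ultra_op f F p\<close>.\<close>

lemma ultra_op_lift:
  assumes q: "ultrafilter q" "q \<le> ultra_op f F p" and p: "ultrafilter p"
  obtains r where "ultrafilter r" "r \<le> F" "ultra_op f r p = q"
proof -
  define L where "L Q u \<longleftrightarrow> (\<forall>\<^sub>F x in p. Q (f u x))" for Q u
  \<comment> \<open>\<open>G\<close> demands of \<open>r\<close> that \<open>L Q\<close> be large
    for each \<open>Q\<close> large along \<open>q\<close>. It is proper: if \<open>L Q\<close>
    failed along \<open>F\<close>, then \<open>Q\<close> would fail along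
    \<open>ultra_op f F p\<close> and hence along \<open>q\<close>.\<close>
  define G where "G = (INF Q\<in>{Q. eventually Q q}. inf F (principal {u. L Q u}))"
  have ev_G: "eventually P G \<longleftrightarrow> (\<exists>Q\<in>{Q. eventually Q q}. eventually P (inf F (principal {u. L Q u})))" for P
    unfolding G_def
  proof (rule eventually_INF_base)
    show "{Q. eventually Q q} \<noteq> {}" using eventually_True by blast
    fix Q Q' assume "Q \<in> {Q. eventually Q q}" "Q' \<in> {Q. eventually Q q}"
    then show "\<exists>R\<in>{Q. eventually Q q}. inf F (principal {u. L R u})
        \<le> inf (inf F (principal {u. L Q u})) (inf F (principal {u. L Q' u}))"
      by (intro bexI[of _ "\<lambda>x. Q x \<and> Q' x"])
        (auto simp: eventually_conj_iff L_def intro!: le_infI2)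
  qed
  have "\<not> eventually (\<lambda>x. False) G"
  proof
    assume "eventually (\<lambda>x. False) G"
    then obtain Q where Q: "eventually Q q" "eventually (\<lambda>u. \<not> L Q u) F"
      unfolding ev_G by (auto simp: eventually_inf_principal)
    then have "eventually (\<lambda>x. \<not> Q x) (ultra_op f F p)"
      using ultrafilter_eventually_not[OF p] by (simp add: eventually_ultra_op L_def)
    then have "eventually (\<lambda>x. \<not> Q x) q" using q(2) by (rule filter_leD[rotated])
    then show False using Q(1) ultrafilter_eventually_not[OF q(1)] by blast
  qed
  then have "G \<noteq> bot" by (simp add: trivial_limit_def)
  then obtain r where r: "r \<le> G" "ultrafilter r" by (rule exists_ultrafilter_le)
  have "G \<le> F"
    unfolding G_def by (rule INF_lower2[of "\<lambda>x. True"]) auto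
  then have rF: "r \<le> F" using r(1) by (rule order_trans[rotated])
  have "ultra_op f r p \<le> q"
  proof (rule filter_leI)
    fix Q assume "eventually Q q"
    then have "eventually (L Q) G"
      unfolding ev_G by (auto simp: eventually_inf_principal)
    then have "eventually (L Q) r" using r(1) by (rule filter_leD[rotated])
    then show "eventually Q (ultra_op f r p)" by (simp add: eventually_ultra_op L_def[abs_def])
  qed
  then have "ultra_op f r p = q"
    using q(1) ultrafilter_ultra_op[OF r(2) p] by (intro ultrafilter_le_imp_eq ultrafilter_not_bot)
  then show ?thesis using that r(2) rF by blast
qed

lemma ultra_closed_ultra_op_image:
  assumes "ultrafilter p"
  shows "ultra_closed {ultra_op f r p | r. ultrafilter r \<and> r \<le> F}"
proof (rule ultra_closedI)
  fix q assume "q \<in> {ultra_op f r p | r. ultrafilter r \<and> r \<le> F}"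
  then show "ultrafilter q" using assms ultrafilter_ultra_op by blast
next
  fix q assume q: "ultrafilter q" "q \<le> Sup {ultra_op f r p | r. ultrafilter r \<and> r \<le> F}"
  have "Sup {ultra_op f r p | r. ultrafilter r \<and> r \<le> F} \<le> ultra_op f F p"
    by (rule Sup_least) (auto intro: ultra_op_mono)
  with q(2) have "q \<le> ultra_op f F p" by (rule order_trans)
  then obtain r where "ultrafilter r" "r \<le> F" "ultra_op f r p = q"
    by (rule ultra_op_lift[OF q(1) _ assms])
  then show "q \<in> {ultra_op f r p | r. ultrafilter r \<and> r \<le> F}" by blast
qed

section \<open>Minimal invariant sets and idempotents in a semigroup of ultrafilters\<close>

text \<open>\<open>U\<close> collects the translations allowed: the whole ring for addition, the
  nonzero elements for multiplication.\<close>

locale ultra_semigroup =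
  fixes f :: "'a \<Rightarrow> 'a \<Rightarrow> 'a" and U :: "'a set"
  assumes f_assoc: "f (f a b) c = f a (f b c)"
    and U_closed: "a \<in> U \<Longrightarrow> b \<in> U \<Longrightarrow> f a b \<in> U"
    and U_nonempty: "U \<noteq> {}"
begin

abbreviation dot :: "'a filter \<Rightarrow> 'a filter \<Rightarrow> 'a filter" where
  "dot \<equiv> ultra_op f"

lemma dot_assoc: "dot (dot p q) r = dot p (dot q r)"
  by (simp add: filter_eq_iff eventually_ultra_op f_assoc)

definition invariant :: "'a filter set \<Rightarrow> bool" where
  "invariant Y \<longleftrightarrow> (\<forall>p\<in>Y. \<forall>u\<in>U. dot (principal {u}) p \<in> Y)"

definition minimal :: "'a filter set \<Rightarrow> bool" where
  "minimal Y \<longleftrightarrow> ultra_closed Y \<and> Y \<noteq> {} \<and> invariant Y \<and>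
     (\<forall>Z. Z \<subseteq> Y \<longrightarrow> ultra_closed Z \<longrightarrow> Z \<noteq> {} \<longrightarrow> invariant Z \<longrightarrow> Z = Y)"

text \<open>The product \<open>dot r p\<close> is the limit of the translates of \<open>p\<close> by
  elements of \<open>U\<close>, and \<open>Y\<close> is closed.\<close>

lemma invariant_dot:
  assumes Y: "ultra_closed Y" "invariant Y" "p \<in> Y" and r: "ultrafilter r" "r \<le> principal U"
  shows "dot r p \<in> Y"
proof -
  have "dot r p \<le> Sup Y"
  proof (rule filter_leI)
    fix P assume P: "eventually P (Sup Y)"
    have "\<forall>\<^sub>F x in p. P (f u x)" if "u \<in> U" for u
    proof -
      have "dot (principal {u}) p \<in> Y" using Y that by (simp add: invariant_def)
      then have "eventually P (dot (principal {u}) p)" using P by (simp add: eventually_Sup)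
      then show ?thesis by (simp add: ultra_op_principal eventually_filtermap)
    qed
    moreover have "eventually (\<lambda>u. u \<in> U) r"
      using r(2) by (simp add: le_filter_def eventually_principal)
    ultimately show "eventually P (dot r p)"
      by (simp add: eventually_ultra_op) (metis (mono_tags, lifting) eventually_mono)
  qed
  then show ?thesis
    using Y ultrafilter_ultra_op[OF r(1) ultra_closed_ultrafilter[OF Y(1,3)]]
    by (simp add: ultra_closed_def)
qed

text \<open>The orbit closure of \<open>p\<close> under translation by \<open>U\<close>;
  \<open>p\<close> itself may lie outside it.\<close>

definition left_ideal :: "'a filter \<Rightarrow> 'a filter set" where
  "left_ideal p = {dot r p | r. ultrafilter r \<and> r \<le> principal U}"

lemma left_ideal_closed: "ultrafilter p \<Longrightarrow> ultra_closed (left_ideal p)"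
  unfolding left_ideal_def by (rule ultra_closed_ultra_op_image)

lemma left_ideal_nonempty: "left_ideal p \<noteq> {}"
proof -
  obtain u where "u \<in> U" using U_nonempty by blast
  then have "dot (principal {u}) p \<in> left_ideal p"
    unfolding left_ideal_def using ultrafilter_principal[of u] by force
  then show ?thesis by blast
qed

lemma left_ideal_invariant: "invariant (left_ideal p)"
  unfolding invariant_def
proof (intro ballI)
  fix q u assume q: "q \<in> left_ideal p" and u: "u \<in> U"
  then obtain r where r: "q = dot r p" "ultrafilter r" "r \<le> principal U"
    unfolding left_ideal_def by blast
  have "ultrafilter (dot (principal {u}) r)"
    by (rule ultrafilter_ultra_op[OF ultrafilter_principal r(2)])
  moreover have "dot (principal {u}) r \<le> principal U"
    using r(3) u U_closed
    by (auto simp: ultra_op_principal le_principal eventually_filtermap elim: eventually_mono)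
  ultimately show "dot (principal {u}) q \<in> left_ideal p"
    unfolding r(1) left_ideal_def dot_assoc[symmetric] by blast
qed

lemma left_ideal_subset:
  "ultra_closed Y \<Longrightarrow> invariant Y \<Longrightarrow> p \<in> Y \<Longrightarrow> left_ideal p \<subseteq> Y"
  unfolding left_ideal_def using invariant_dot by blast

lemma minimal_left_ideal_eq:
  assumes "minimal Y" "p \<in> Y"
  shows "left_ideal p = Y"
proof -
  have Y: "ultra_closed Y" "invariant Y"
    and min: "\<And>Z. Z \<subseteq> Y \<Longrightarrow> ultra_closed Z \<Longrightarrow> Z \<noteq> {} \<Longrightarrow> invariant Z \<Longrightarrow> Z = Y"
    using assms(1) by (simp_all add: minimal_def)
  show ?thesis
    by (intro min left_ideal_subset[OF Y assms(2)] left_ideal_closed left_ideal_nonempty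
        left_ideal_invariant ultra_closed_ultrafilter[OF Y(1) assms(2)])
qed

text \<open>The orbit closure of \<open>dot t q\<close> is all of \<open>Y\<close>, so every
  translation away from \<open>q\<close> can be undone. Minimality enters most later arguments in
  this form.\<close>

lemma minimal_return:
  assumes Y: "minimal Y" "q \<in> Y" and t: "ultrafilter t" "t \<le> principal U"
  obtains r where "ultrafilter r" "r \<le> principal U" "dot r (dot t q) = q"
proof -
  have "dot t q \<in> Y" using Y t by (intro invariant_dot) (simp_all add: minimal_def)
  then have "left_ideal (dot t q) = Y" by (rule minimal_left_ideal_eq[OF Y(1)])
  with Y(2) have "q \<in> left_ideal (dot t q)" by simp
  then obtain r where "q = dot r (dot t q)" "ultrafilter r" "r \<le> principal U"
    unfolding left_ideal_def by blast
  then show ?thesis using that[of r] by simp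
qed

lemma exists_minimal:
  assumes "ultra_closed Y" "Y \<noteq> {}" "invariant Y"
  obtains M where "M \<subseteq> Y" "minimal M"
proof -
  have "invariant (\<Inter>C)" if "\<And>Z. Z \<in> C \<Longrightarrow> ultra_closed Z \<and> invariant Z" for C
    using that unfolding invariant_def by blast
  then obtain M where "M \<subseteq> Y" "ultra_closed M" "M \<noteq> {}" "invariant M"
    "\<And>Z. Z \<subseteq> M \<Longrightarrow> ultra_closed Z \<Longrightarrow> Z \<noteq> {} \<Longrightarrow> invariant Z \<Longrightarrow> Z = M"
    using exists_minimal_ultra_closed[of Y invariant, OF assms] by metis
  then show ?thesis by (intro that[of M]) (simp_all add: minimal_def)
qed

text \<open>The Ellis-Numakura argument. For \<open>p\<close> in a minimal closed subsemigroup
  \<open>M\<close>, the products of members of \<open>M\<close> with \<open>p\<close> form another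
  one, so they fill \<open>M\<close> and include \<open>p\<close>. Then the solutions
  \<open>r\<close> of \<open>dot r p = p\<close> form a nonempty closed subsemigroup, which is again
  all of \<open>M\<close> and so contains \<open>p\<close>.\<close>

lemma Ellis_idempotent:
  assumes Y: "ultra_closed Y" "Y \<noteq> {}" "\<And>p q. p \<in> Y \<Longrightarrow> q \<in> Y \<Longrightarrow> dot p q \<in> Y"
  obtains p where "p \<in> Y" "dot p p = p"
proof -
  define \<Phi> where "\<Phi> Z \<longleftrightarrow> (\<forall>p\<in>Z. \<forall>q\<in>Z. dot p q \<in> Z)" for Z
  have "\<Phi> Y" using Y(3) by (simp add: \<Phi>_def)
  moreover have "\<Phi> (\<Inter>C)" if "\<And>Z. Z \<in> C \<Longrightarrow> ultra_closed Z \<and> \<Phi> Z" for C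
    using that unfolding \<Phi>_def by blast
  ultimately obtain M where M: "M \<subseteq> Y" "ultra_closed M" "M \<noteq> {}" "\<Phi> M"
    and min: "\<And>Z. Z \<subseteq> M \<Longrightarrow> ultra_closed Z \<Longrightarrow> Z \<noteq> {} \<Longrightarrow> \<Phi> Z \<Longrightarrow> Z = M"
    using exists_minimal_ultra_closed[of Y \<Phi>, OF Y(1,2)] by metis
  obtain p where p: "p \<in> M" using M(3) by blast
  have uf: "ultrafilter q" if "q \<in> M" for q using M(2) that by (rule ultra_closed_ultrafilter)
  have in_M: "q \<in> M \<longleftrightarrow> ultrafilter q \<and> q \<le> Sup M" for q
    using M(2) by (auto simp: ultra_closed_def intro: Sup_upper)
  define Z where "Z = {dot r p | r. ultrafilter r \<and> r \<le> Sup M}"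
  have Z_eq: "Z = {dot r p | r. r \<in> M}" unfolding Z_def in_M ..
  have "Z = M"
  proof (rule min)
    show "Z \<subseteq> M" using M(4) p unfolding Z_eq \<Phi>_def by blast
    have "dot (dot r p) (dot s p) \<in> Z" if "r \<in> M" "s \<in> M" for r s
    proof -
      have "dot (dot r p) s \<in> M" using M(4) p that by (simp add: \<Phi>_def)
      then show ?thesis unfolding Z_eq dot_assoc[symmetric] by blast
    qed
    then show "\<Phi> Z" unfolding \<Phi>_def by (auto simp: Z_eq)
    show "ultra_closed Z" unfolding Z_def by (rule ultra_closed_ultra_op_image[OF uf[OF p]])
    show "Z \<noteq> {}" using p unfolding Z_eq by blast
  qed
  with p have "p \<in> Z" by simp
  then obtain r where r: "r \<in> M" "dot r p = p" unfolding Z_eq by auto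
  define W where "W = {r \<in> M. dot r p = p}"
  have "W = M"
  proof (rule min)
    show "W \<subseteq> M" "W \<noteq> {}" using r by (auto simp: W_def)
    show "\<Phi> W" using M(4) by (auto simp: \<Phi>_def W_def dot_assoc)
    show "ultra_closed W"
    proof (rule ultra_closedI)
      fix s assume s: "ultrafilter s" "s \<le> Sup W"
      have "Sup W \<le> Sup M" by (rule Sup_subset_mono) (auto simp: W_def)
      then have "s \<in> M" using s in_M by auto
      \<comment> \<open>Right translation by \<open>p\<close> is continuous, so the equation
        defining \<open>W\<close> passes to ultrafilters below \<open>Sup W\<close>.\<close>
      have "dot s p \<le> p"
      proof (rule filter_leI)
        fix P assume P: "eventually P p"
        have "\<forall>\<^sub>F u in r'. \<forall>\<^sub>F x in p. P (f u x)" if "r' \<in> W" for r'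
        proof -
          have "dot r' p = p" using that by (simp add: W_def)
          then have "eventually P (dot r' p)" using P by simp
          then show ?thesis by (simp add: eventually_ultra_op)
        qed
        then have "\<forall>\<^sub>F u in Sup W. \<forall>\<^sub>F x in p. P (f u x)" by (simp add: eventually_Sup)
        then show "eventually P (dot s p)"
          unfolding eventually_ultra_op using s(2) by (rule filter_leD[rotated])
      qed
      then have "dot s p = p"
        using ultrafilter_ultra_op[OF s(1) uf[OF p]] uf[OF p]
        by (intro ultrafilter_le_imp_eq ultrafilter_not_bot)
      then show "s \<in> W" using \<open>s \<in> M\<close> by (simp add: W_def)
    qed (use uf in \<open>auto simp: W_def\<close>)
  qed
  then have "dot p p = p" using p by (auto simp: W_def)
  then show ?thesis using p M(1) that by blast
qed

lemma minimal_idempotent: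
  assumes "minimal Y" "\<And>p. p \<in> Y \<Longrightarrow> p \<le> principal U"
  obtains p where "p \<in> Y" "dot p p = p"
proof (rule Ellis_idempotent[of Y])
  show "dot p q \<in> Y" if "p \<in> Y" "q \<in> Y" for p q
    using assms that ultra_closed_ultrafilter[of Y p]
    by (intro invariant_dot) (simp_all add: minimal_def)
qed (use assms that in \<open>auto simp: minimal_def\<close>)

end

section \<open>The additive and multiplicative semigroups of ultrafilters on the ring\<close>

lemma ultra_semigroup_add: "ultra_semigroup (\<lambda>u x :: 'a::idom. x + u) UNIV"
  by unfold_locales (auto simp: algebra_simps)

lemma ultra_semigroup_mult: "ultra_semigroup ((*) :: 'a::idom \<Rightarrow> _) (- {0})"
proof unfold_locales
  show "- {0 :: 'a} \<noteq> {}" using one_neq_zero by blast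
qed (auto simp: algebra_simps)

interpretation uadd: ultra_semigroup "\<lambda>u x :: 'a::idom. x + u" UNIV
  by (rule ultra_semigroup_add)

interpretation umult: ultra_semigroup "(*) :: 'a::idom \<Rightarrow> _" "- {0}"
  by (rule ultra_semigroup_mult)

lemma AMI_iff:
  "q \<in> AMI \<longleftrightarrow> ultrafilter q \<and> nonprincipal q \<and> ultra_add q q = q \<and> (\<exists>Y. uadd.minimal Y \<and> q \<in> Y)"
proof -
  have "compact_SA_invariant Y \<and> (\<forall>Z. compact_SA_invariant Z \<and> Z \<subseteq> Y \<longrightarrow> Z = Y) \<longleftrightarrow> uadd.minimal Y"
    for Y :: "'a filter set"
    unfolding compact_SA_invariant_def uadd.minimal_def compactin_beta_iff SA_invariant_def
      uadd.invariant_def ultra_add_eq_op by blast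
  then show ?thesis unfolding AMI_def by blast
qed

lemma beta_star_iff: "p \<in> beta_star \<longleftrightarrow> ultrafilter p \<and> p \<le> principal (- {0})"
  by (simp add: beta_star_def le_principal Compl_eq_Diff_UNIV)

text \<open>\<open>umult.minimal\<close> compares with closed invariant sets of arbitrary
  ultrafilters, \<open>MMI\<close> with those inside \<open>beta_star\<close>. For \<open>Y\<close>
  inside \<open>beta_star\<close> the two notions of minimality agree, since subsets of
  \<open>Y\<close> lie there too.\<close>

lemma MMI_I:
  assumes "umult.minimal Y" "Y \<subseteq> beta_star" "p \<in> Y" "nonprincipal p" "ultra_mult p p = p"
  shows "p \<in> MMI"
proof -
  have "compact_SM_invariant Y \<and> (\<forall>Z. compact_SM_invariant Z \<and> Z \<subseteq> Y \<longrightarrow> Z = Y)"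
    using assms(1,2) unfolding compact_SM_invariant_def umult.minimal_def compactin_beta_iff
      SM_invariant_def umult.invariant_def ultra_mult_eq_op by auto
  then show ?thesis
    using assms unfolding MMI_def by blast
qed

lemma nonprincipal_iff:
  assumes "ultrafilter p"
  shows "nonprincipal p \<longleftrightarrow> (\<forall>u. eventually (\<lambda>x. x \<noteq> u) p)"
proof
  assume np: "nonprincipal p"
  show "\<forall>u. eventually (\<lambda>x. x \<noteq> u) p"
  proof
    fix u
    show "eventually (\<lambda>x. x \<noteq> u) p"
    proof (rule ccontr)
      assume "\<not> eventually (\<lambda>x. x \<noteq> u) p"
      then have "eventually (\<lambda>x. x = u) p"
        using ultrafilter_eventually_not[OF assms, of "\<lambda>x. x = u"] by blast
      then have "p \<le> principal {u}" by (simp add: le_principal)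
      then have "p = principal {u}"
        using assms ultrafilter_principal by (intro ultrafilter_le_imp_eq ultrafilter_not_bot)
      then show False using np by (simp add: nonprincipal_def)
    qed
  qed
next
  assume "\<forall>u. eventually (\<lambda>x. x \<noteq> u) p"
  then show "nonprincipal p"
    unfolding nonprincipal_def by (auto simp: eventually_principal dest: spec)
qed

section \<open>Dilations, and DC* sets are affinely syndetic\<close>

lemma ultra_add_dilate:
  fixes c :: "'a::idom"
  shows "ultra_add (filtermap ((*) c) p) (filtermap ((*) c) q) = filtermap ((*) c) (ultra_add p q)"
  by (simp add: filter_eq_iff eventually_ultra_add eventually_filtermap distrib_left)

lemma ultrafilter_filtermap_lift:
  assumes "ultrafilter s" "s \<le> principal (range f)"
  obtains t where "ultrafilter t" "filtermap f t = s"
proof -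
  have "filtercomap f s \<noteq> bot"
  proof
    assume "filtercomap f s = bot"
    then have "eventually (\<lambda>x. False) (filtercomap f s)" by simp
    then obtain Q where Q: "eventually Q s" "\<And>x. \<not> Q (f x)"
      by (auto simp: eventually_filtercomap)
    have "eventually (\<lambda>x. x \<in> range f) s"
      using assms(2) by (simp add: le_principal)
    with Q(1) have "eventually (\<lambda>x. False) s" by eventually_elim (use Q(2) in auto)
    then show False using ultrafilter_not_bot[OF assms(1)] by (simp add: trivial_limit_def)
  qed
  then obtain t where t: "t \<le> filtercomap f s" "ultrafilter t" by (rule exists_ultrafilter_le)
  have "filtermap f t \<le> filtermap f (filtercomap f s)" using t(1) by (rule filtermap_mono)
  also have "\<dots> \<le> s" by (rule filtermap_filtercomap)
  finally have "filtermap f t = s"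
    using assms(1) ultrafilter_filtermap[OF t(2)] by (intro ultrafilter_le_imp_eq ultrafilter_not_bot)
  then show ?thesis using that t(2) by blast
qed

text \<open>Dilation by \<open>c\<close> is an additive homomorphism, so idempotency is preserved.
  Minimality survives because the ideal cR has finite index: every ultrafilter has a translate
  living on cR, which is the dilate of an ultrafilter, and so the return property of
  \<open>q\<close> carries over to its dilate.\<close>

lemma AMI_dilate:
  fixes c :: "'a::idom"
  assumes R: "large_ideal_domain TYPE('a)" and q: "q \<in> AMI" and c: "c \<noteq> 0"
  shows "filtermap ((*) c) q \<in> AMI"
proof -
  from q obtain Y where uf: "ultrafilter q" and np: "nonprincipal q" and idem: "ultra_add q q = q"
    and Y: "uadd.minimal Y" "q \<in> Y"
    unfolding AMI_iff by blast
  define d where "d = filtermap ((*) c) q"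
  have uf_d: "ultrafilter d" unfolding d_def using uf by (rule ultrafilter_filtermap)
  have idem_d: "ultra_add d d = d" unfolding d_def ultra_add_dilate idem ..
  have np_d: "nonprincipal d"
    unfolding nonprincipal_iff[OF uf_d]
  proof
    fix u
    show "eventually (\<lambda>x. x \<noteq> u) d"
    proof (cases "\<exists>y. u = c * y")
      case True
      then obtain y where "u = c * y" by blast
      moreover have "eventually (\<lambda>x. x \<noteq> y) q" using np uf by (simp add: nonprincipal_iff)
      ultimately show ?thesis
        unfolding d_def eventually_filtermap using c by simp
    next
      case False
      then have "c * x \<noteq> u" for x by metis
      then show ?thesis unfolding d_def eventually_filtermap by simp
    qed
  qed
  have min: "uadd.minimal (uadd.left_ideal d)"
    unfolding uadd.minimal_def
  proof (intro conjI allI impI)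
    fix Z assume Z: "Z \<subseteq> uadd.left_ideal d" "ultra_closed Z" "Z \<noteq> {}" "uadd.invariant Z"
    then obtain z where z: "z \<in> Z" by blast
    then obtain r where r: "ultrafilter r" "z = ultra_add r d"
      using Z(1) unfolding uadd.left_ideal_def ultra_add_eq_op by blast
    have fin: "finite (range (\<lambda>r. (+) r ` range ((*) c)))"
      using R c unfolding large_ideal_domain_def by blast
    have "u \<in> (+) u ` range ((*) c)" for u
      by (rule image_eqI[of _ _ "c * 0"]) auto
    then have "eventually (\<lambda>u. \<exists>I\<in>range (\<lambda>r. (+) r ` range ((*) c)). u \<in> I) r"
      by (intro always_eventually) blast
    from ultrafilter_eventually_finite_bex[OF r(1) fin this]
    obtain w where w: "eventually (\<lambda>u. u \<in> (+) w ` range ((*) c)) r" by blast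
    define s where "s = ultra_add (principal {- w}) r"
    have s_eq: "s = filtermap (\<lambda>x. x - w) r"
      by (simp add: s_def ultra_add_eq_op ultra_op_principal)
    have uf_s: "ultrafilter s" unfolding s_eq using r(1) by (rule ultrafilter_filtermap)
    have "s \<le> principal (range ((*) c))"
      unfolding le_principal s_eq eventually_filtermap using w by eventually_elim auto
    then obtain t where t: "ultrafilter t" "filtermap ((*) c) t = s"
      by (rule ultrafilter_filtermap_lift[OF uf_s])
    have "ultra_add (principal {- w}) z \<in> Z"
      using Z(4) z unfolding uadd.invariant_def ultra_add_eq_op by blast
    also have "ultra_add (principal {- w}) z = ultra_add s d"
      unfolding r(2) s_def ultra_add_eq_op uadd.dot_assoc ..
    also have "\<dots> = filtermap ((*) c) (ultra_add t q)"
      unfolding t(2)[symmetric] d_def by (rule ultra_add_dilate)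
    finally have in_Z: "filtermap ((*) c) (ultra_add t q) \<in> Z" .
    \<comment> \<open>Minimality of \<open>Y\<close> undoes the translation by \<open>t\<close>;
      dilating this return by \<open>c\<close> brings \<open>d\<close> into
      \<open>Z\<close>.\<close>
    obtain r' where r': "ultrafilter r'" "ultra_add r' (ultra_add t q) = q"
      using uadd.minimal_return[OF Y t(1)] unfolding ultra_add_eq_op by auto
    have "d = ultra_add (filtermap ((*) c) r') (filtermap ((*) c) (ultra_add t q))"
      unfolding ultra_add_dilate r'(2) d_def ..
    also have "\<dots> \<in> Z"
      unfolding ultra_add_eq_op
      by (rule uadd.invariant_dot[OF Z(2,4) in_Z[unfolded ultra_add_eq_op]])
        (simp_all add: r'(1) ultrafilter_filtermap)
    finally have "d \<in> Z" .
    then show "Z = uadd.left_ideal d"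
      using Z(1) uadd.left_ideal_subset[OF Z(2,4)] by blast
  qed (simp_all add: uadd.left_ideal_closed uf_d uadd.left_ideal_nonempty uadd.left_ideal_invariant)
  have "d \<in> uadd.left_ideal d"
    unfolding uadd.left_ideal_def ultra_add_eq_op[symmetric]
    using idem_d uf_d by force
  then show ?thesis
    unfolding d_def[symmetric] AMI_iff using uf_d np_d idem_d min by blast
qed

lemma affine_semigroup_iff: "g \<in> affine_semigroup \<longleftrightarrow> (\<exists>u v. u \<noteq> 0 \<and> g = (\<lambda>x. u * x + v))"
  by (auto simp: affine_semigroup_def)

lemma affine_comp_translate:
  assumes "g \<in> affine_semigroup"
  shows "(\<lambda>x. g (x + w)) \<in> affine_semigroup"
proof -
  obtain u v where g: "u \<noteq> 0" "g = (\<lambda>x. u * x + v)" using assms affine_semigroup_iff by blast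
  then have "(\<lambda>x. g (x + w)) = (\<lambda>x. u * x + (u * w + v))" by (simp add: algebra_simps)
  then show ?thesis using g(1) affine_semigroup_iff by blast
qed

lemma affine_comp_dilate:
  assumes "g \<in> affine_semigroup" "w \<noteq> 0"
  shows "(\<lambda>x. g (w * x)) \<in> affine_semigroup"
proof -
  obtain u v where g: "u \<noteq> 0" "g = (\<lambda>x. u * x + v)" using assms(1) affine_semigroup_iff by blast
  then have "(\<lambda>x. g (w * x)) = (\<lambda>x. (u * w) * x + v)" by (simp add: algebra_simps)
  moreover have "u * w \<noteq> 0" using g(1) assms(2) by simp
  ultimately show ?thesis using affine_semigroup_iff by blast
qed

text \<open>A minimal set inside \<open>X\<close> supplies an idempotent; the point is that it is
  nonprincipal. Translating a principal \<open>q\<close> by a nonprincipal \<open>r\<close> gives an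
  ultrafilter that no further translation makes principal again, contrary to
  \<open>minimal_return\<close>.\<close>

lemma exists_minimal_additive_idempotent:
  fixes X :: "'a::idom filter set"
  assumes inf: "infinite (UNIV :: 'a set)"
    and X: "ultra_closed X" "X \<noteq> {}" "uadd.invariant X"
  shows "X \<inter> AMI \<noteq> {}"
proof -
  obtain Y where Y: "Y \<subseteq> X" "uadd.minimal Y" using uadd.exists_minimal[OF X] by blast
  then obtain q where q: "q \<in> Y" "ultra_add q q = q"
    using uadd.minimal_idempotent[OF Y(2)] unfolding ultra_add_eq_op by auto
  have uf: "ultrafilter q" using X(1) Y(1) q(1) by (auto simp: ultra_closed_def)
  have "nonprincipal q"
    unfolding nonprincipal_def
  proof (intro allI notI)
    fix w assume w: "q = principal {w}"
    have "(cofinite :: 'a filter) \<noteq> bot" using inf by simp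
    then obtain r :: "'a filter" where r: "r \<le> cofinite" "ultrafilter r" by (rule exists_ultrafilter_le)
    obtain t where t: "ultrafilter t" "ultra_add t (ultra_add r q) = q"
      using uadd.minimal_return[OF Y(2) q(1) r(2)] unfolding ultra_add_eq_op by auto
    have "eventually (\<lambda>x. x = w) (ultra_add t (ultra_add r q))"
      unfolding t(2) by (simp add: w eventually_principal)
    then have "eventually (\<lambda>u. eventually (\<lambda>v. v + u = 0) r) t"
      by (simp add: eventually_ultra_add w eventually_principal add.assoc)
    then obtain u where u: "eventually (\<lambda>v. v + u = 0) r"
      using ultrafilter_not_bot[OF t(1)] eventually_happens by blast
    have "eventually (\<lambda>v. v \<noteq> - u) r"
      using r(1) by (rule filter_leD) (simp add: eventually_cofinite)
    with u have "eventually (\<lambda>v. False) r"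
      by eventually_elim (simp add: eq_neg_iff_add_eq_0)
    then show False using ultrafilter_not_bot[OF r(2)] by (simp add: trivial_limit_def)
  qed
  then have "q \<in> AMI" using uf q Y(2) unfolding AMI_iff by blast
  then show ?thesis using q(1) Y(1) by blast
qed

lemma DC_star_imp_affinely_syndetic:
  fixes S :: "'a::idom set"
  assumes R: "large_ideal_domain TYPE('a)" and S: "DC_star S"
  shows "affinely_syndetic S"
proof (rule ccontr)
  assume not_synd: "\<not> affinely_syndetic S"
  have inf: "infinite (UNIV :: 'a set)" using R by (simp add: large_ideal_domain_def)
  \<comment> \<open>\<open>H\<close> is generated by the sets of those \<open>x\<close> that
    \<open>g\<close> maps outside \<open>S\<close>. Failure of syndeticity says that any finitely
    many of these sets have a common point.\<close>
  define H where "H = (INF g\<in>affine_semigroup. principal {x. g x \<notin> S})"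
  define X where "X = {p. ultrafilter p \<and> p \<le> H}"
  have "H \<noteq> bot"
    unfolding H_def
  proof (rule INF_filter_not_bot)
    fix F assume F: "F \<subseteq> affine_semigroup" "finite (F :: ('a \<Rightarrow> 'a) set)"
    then have "\<not> (\<forall>x. \<exists>g\<in>F. g x \<in> S)"
      using not_synd by (auto simp: affinely_syndetic_def)
    then obtain x where "\<And>g. g \<in> F \<Longrightarrow> g x \<notin> S" by blast
    then show "(INF g\<in>F. principal {x. g x \<notin> S}) \<noteq> bot"
      using F(2) by (auto simp: INF_principal_finite principal_eq_bot_iff)
  qed
  then have "X \<noteq> {}" unfolding X_def using exists_ultrafilter_le[of H] by blast
  have cl_X: "ultra_closed X" unfolding X_def by (rule ultra_closed_below)
  have X_iff: "p \<in> X \<longleftrightarrow> ultrafilter p \<and> (\<forall>g\<in>affine_semigroup. eventually (\<lambda>x. g x \<notin> S) p)" for p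
    by (simp add: X_def H_def le_INF_iff le_principal)
  have inv_X: "uadd.invariant X"
    unfolding uadd.invariant_def ultra_op_principal
    by (auto simp: X_iff ultrafilter_filtermap eventually_filtermap affine_comp_translate)
  define A where "A = X \<inter> AMI"
  have "A \<noteq> {}"
    unfolding A_def by (rule exists_minimal_additive_idempotent[OF inf cl_X \<open>X \<noteq> {}\<close> inv_X])
  have A_uf: "ultrafilter q" if "q \<in> A" for q using that by (simp add: A_def X_def)
  have A_np: "eventually (\<lambda>x. x \<noteq> u) q" if "q \<in> A" for q u
    using that nonprincipal_iff[of q] by (simp add: A_def AMI_iff)
  \<comment> \<open>\<open>Z\<close> is the closure of \<open>A\<close>. Dilations by nonzero
    elements preserve both \<open>X\<close> and \<open>AMI\<close>, so \<open>Z\<close> is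
    multiplicatively invariant, and an idempotent from a minimal subset of it is a DC
    ultrafilter.\<close>
  define Z where "Z = {p. ultrafilter p \<and> p \<le> Sup A}"
  have cl_Z: "ultra_closed Z" unfolding Z_def by (rule ultra_closed_below)
  have "A \<subseteq> Z" using A_uf by (auto simp: Z_def intro: Sup_upper)
  then have "Z \<noteq> {}" using \<open>A \<noteq> {}\<close> by blast
  have inv_Z: "umult.invariant Z"
    unfolding umult.invariant_def ultra_op_principal
  proof (intro ballI)
    fix p u assume p: "p \<in> Z" and u: "u \<in> - {0 :: 'a}"
    have "filtermap ((*) u) q \<in> A" if "q \<in> A" for q
      using that u AMI_dilate[OF R, of q u]
      by (auto simp: A_def X_iff ultrafilter_filtermap eventually_filtermap affine_comp_dilate)
    then have "filtermap ((*) u) (Sup A) \<le> Sup A"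
      unfolding le_filter_def eventually_filtermap[symmetric] eventually_Sup
      by (metis eventually_Sup eventually_filtermap)
    moreover have "filtermap ((*) u) p \<le> filtermap ((*) u) (Sup A)"
      using p by (intro filtermap_mono) (simp add: Z_def)
    ultimately show "filtermap ((*) u) p \<in> Z"
      using p by (simp add: Z_def ultrafilter_filtermap)
  qed
  have Z_np: "eventually (\<lambda>x. x \<noteq> u) p" if "p \<in> Z" for p u
    using that A_np by (auto simp: Z_def le_filter_def eventually_Sup)
  have Z_star: "p \<in> beta_star" if "p \<in> Z" for p
    using that Z_np[OF that, of 0] by (simp add: beta_star_def Z_def)
  obtain M where M: "M \<subseteq> Z" "umult.minimal M" using umult.exists_minimal[OF cl_Z \<open>Z \<noteq> {}\<close> inv_Z] by blast
  have "p \<le> principal (- {0})" if "p \<in> M" for p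
    using Z_star[of p] that M(1) by (auto simp: beta_star_iff)
  then obtain p where p: "p \<in> M" "ultra_mult p p = p"
    using umult.minimal_idempotent[OF M(2)] unfolding ultra_mult_eq_op by auto
  then have pZ: "p \<in> Z" and uf: "ultrafilter p" using M(1) by (auto simp: Z_def)
  have "p \<in> MMI"
    using M Z_star p Z_np[OF pZ] nonprincipal_iff[OF uf] by (intro MMI_I[of M]) auto
  moreover have "p \<in> beta_topology closure_of AMI"
  proof -
    have "Sup A \<le> Sup AMI" by (rule Sup_subset_mono) (simp add: A_def)
    then show ?thesis
      using pZ by (subst in_beta_closure_iff) (auto simp: AMI_iff Z_def)
  qed
  ultimately have "p \<in> DC_ultrafilters" by (simp add: DC_ultrafilters_def)
  then have "eventually (\<lambda>x. x \<in> S) p" using S by (simp add: DC_star_iff)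
  moreover have "p \<in> X"
  proof -
    have "Sup A \<le> Sup X" by (rule Sup_subset_mono) (simp add: A_def)
    then show ?thesis using pZ cl_X by (auto simp: Z_def ultra_closed_def)
  qed
  then have "eventually (\<lambda>x. x \<notin> S) p"
  proof -
    \<comment> \<open>The identity map is affine, so membership in \<open>X\<close> makes the
      complement of \<open>S\<close> itself large.\<close>
    have "(\<lambda>x :: 'a. x) \<in> affine_semigroup"
      unfolding affine_semigroup_iff by (intro exI[of _ 1] exI[of _ 0]) simp
    with \<open>p \<in> X\<close> show ?thesis by (auto simp: X_iff dest: bspec)
  qed
  ultimately show False using ultrafilter_eventually_not[OF uf] by blast
qed

section \<open>Limits along ultrafilters and semi-inner products\<close>

text \<open>The discriminant criterion including the degenerate case \<open>s = 0\<close>. It yields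
  both \<open>Cauchy_Schwarz\<close> and the error bound in
  \<open>approximate_Riesz\<close>.\<close>

lemma quadratic_nonneg_discriminant:
  fixes c d s :: real
  assumes "\<And>t. c + 2 * t * d + t\<^sup>2 * s \<ge> 0" "s \<ge> 0"
  shows "d\<^sup>2 \<le> c * s"
proof (cases "s = 0")
  case True
  have "d = 0"
  proof (rule ccontr)
    assume "d \<noteq> 0"
    \<comment> \<open>At this value of \<open>t\<close> the expression equals -1.\<close>
    then show False using assms(1)[of "- (c + 1) / (2 * d)"] True by (simp add: field_simps)
  qed
  then show ?thesis using True by simp
next
  case False
  then have "s > 0" using assms(2) by simp
  then show ?thesis
    using assms(1)[of "- d / s"] by (simp add: field_simps power2_eq_square)
qed

text \<open>The image ultrafilter lives on a compact interval, so it clusters at a point, and an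
  ultrafilter converges to each of its cluster points. Hence \<open>Lim\<close> of a bounded
  function is a genuine limit.\<close>

lemma ultrafilter_tendsto_Lim:
  fixes \<phi> :: "'a \<Rightarrow> real"
  assumes "ultrafilter p" "\<And>u. \<bar>\<phi> u\<bar> \<le> C"
  shows "(\<phi> \<longlongrightarrow> Lim p \<phi>) p"
proof -
  have uf: "ultrafilter (filtermap \<phi> p)" using assms(1) by (rule ultrafilter_filtermap)
  have "eventually (\<lambda>x. x \<in> {-C..C}) (filtermap \<phi> p)"
    using assms(2) by (auto simp: eventually_filtermap abs_le_iff intro!: always_eventually)
      (metis minus_le_iff)
  moreover have "filtermap \<phi> p \<noteq> bot" using uf by (rule ultrafilter_not_bot)
  ultimately obtain l where "inf (nhds l) (filtermap \<phi> p) \<noteq> bot"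
    using compact_Icc[of "-C" C] unfolding compact_filter by blast
  then have "inf (nhds l) (filtermap \<phi> p) = filtermap \<phi> p"
    using uf by (intro ultrafilter_le_imp_eq) auto
  then have "filtermap \<phi> p \<le> nhds l" by (metis inf.cobounded1)
  then have "(\<phi> \<longlongrightarrow> l) p" by (simp add: filterlim_def)
  moreover have "Lim p \<phi> = l"
    using calculation ultrafilter_not_bot[OF assms(1)] by (intro tendsto_Lim) auto
  ultimately show ?thesis by simp
qed

lemma abs_limit_diff_le:
  fixes a b :: real
  assumes "(\<phi> \<longlongrightarrow> a) p" "(\<psi> \<longlongrightarrow> b) p" "p \<noteq> bot" "\<And>u. \<bar>\<phi> u - \<psi> u\<bar> \<le> e"
  shows "\<bar>a - b\<bar> \<le> e"
  by (rule tendsto_upperbound[OF tendsto_rabs[OF tendsto_diff[OF assms(1,2)]] _ assms(3)])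
    (simp add: assms(4))

lemma abs_Lim_le:
  fixes \<phi> :: "'a \<Rightarrow> real"
  assumes "ultrafilter p" "\<And>u. \<bar>\<phi> u\<bar> \<le> C"
  shows "\<bar>Lim p \<phi>\<bar> \<le> C"
  using abs_limit_diff_le[OF ultrafilter_tendsto_Lim[OF assms] tendsto_const[of 0]
      ultrafilter_not_bot[OF assms(1)]] assms(2) by simp

lemma Lim_ultra_add:
  fixes \<phi> :: "'a::idom \<Rightarrow> real"
  assumes p: "ultrafilter p" and q: "ultrafilter q" and bdd: "\<And>u. \<bar>\<phi> u\<bar> \<le> C"
  shows "Lim (ultra_add p q) \<phi> = Lim p (\<lambda>u. Lim q (\<lambda>x. \<phi> (x + u)))"
proof -
  define \<psi> where "\<psi> u = Lim q (\<lambda>x. \<phi> (x + u))" for u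
  have in_lim: "((\<lambda>x. \<phi> (x + u)) \<longlongrightarrow> \<psi> u) q" for u
    unfolding \<psi>_def by (rule ultrafilter_tendsto_Lim[OF q bdd])
  have out_lim: "(\<psi> \<longlongrightarrow> Lim p \<psi>) p"
    by (rule ultrafilter_tendsto_Lim[OF p, of _ C]) (simp add: \<psi>_def abs_Lim_le[OF q bdd])
  have "(\<phi> \<longlongrightarrow> Lim p \<psi>) (ultra_add p q)"
  proof (rule tendstoI)
    fix e :: real assume "e > 0"
    then have "e / 2 > 0" by simp
    have "\<forall>\<^sub>F u in p. dist (\<psi> u) (Lim p \<psi>) < e / 2"
      using out_lim \<open>e / 2 > 0\<close> by (rule tendstoD)
    then show "\<forall>\<^sub>F x in ultra_add p q. dist (\<phi> x) (Lim p \<psi>) < e"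
      unfolding eventually_ultra_add
    proof eventually_elim
      fix u assume u: "dist (\<psi> u) (Lim p \<psi>) < e / 2"
      have "\<forall>\<^sub>F x in q. dist (\<phi> (x + u)) (\<psi> u) < e / 2"
        using in_lim \<open>e / 2 > 0\<close> by (rule tendstoD)
      then show "\<forall>\<^sub>F x in q. dist (\<phi> (x + u)) (Lim p \<psi>) < e"
      proof eventually_elim
        fix x assume "dist (\<phi> (x + u)) (\<psi> u) < e / 2"
        then show "dist (\<phi> (x + u)) (Lim p \<psi>) < e"
          using u dist_triangle[of "\<phi> (x + u)" "Lim p \<psi>" "\<psi> u"] by linarith
      qed
    qed
  qed
  moreover have "ultra_add p q \<noteq> bot"
    unfolding ultra_add_eq_op using p q by (intro ultrafilter_not_bot ultrafilter_ultra_op)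
  ultimately show ?thesis unfolding \<psi>_def[symmetric] by (intro tendsto_Lim) auto
qed

section \<open>Iterated largeness and product patterns along a multiplicative idempotent\<close>

text \<open>Largeness for the \<open>n\<close>-fold Fubini product of \<open>p\<close>, seen as a
  filter on lists of length \<open>n\<close>.\<close>

primrec iterated_eventually :: "'a filter \<Rightarrow> nat \<Rightarrow> ('a list \<Rightarrow> bool) \<Rightarrow> bool" where
  "iterated_eventually p 0 P \<longleftrightarrow> P []"
| "iterated_eventually p (Suc n) P \<longleftrightarrow> (\<forall>\<^sub>F v in p. iterated_eventually p n (\<lambda>l. P (v # l)))"

lemma iterated_eventually_mono:
  "iterated_eventually p n P \<Longrightarrow> (\<And>l. length l = n \<Longrightarrow> P l \<Longrightarrow> Q l) \<Longrightarrow> iterated_eventually p n Q"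
proof (induction n arbitrary: P Q)
  case (Suc n)
  have "iterated_eventually p n (\<lambda>l. Q (v # l))" if "iterated_eventually p n (\<lambda>l. P (v # l))" for v
    using that by (rule Suc.IH) (simp add: Suc.prems(2))
  then show ?case using Suc.prems(1) by (auto elim: eventually_mono)
qed simp

lemma iterated_eventually_always: "(\<And>l. P l) \<Longrightarrow> iterated_eventually p n P"
  by (induction n arbitrary: P) auto

lemma iterated_eventually_exists:
  "p \<noteq> bot \<Longrightarrow> iterated_eventually p n P \<Longrightarrow> \<exists>l. length l = n \<and> P l"
proof (induction n arbitrary: P)
  case (Suc n)
  then obtain v where "iterated_eventually p n (\<lambda>l. P (v # l))"
    using eventually_happens by fastforce
  from Suc.IH[OF Suc.prems(1) this] show ?case by (metis length_Cons)
qed simp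

lemma iterated_eventually_append:
  "iterated_eventually p (m + n) P \<longleftrightarrow>
     iterated_eventually p m (\<lambda>l. iterated_eventually p n (\<lambda>l'. P (l @ l')))"
  by (induction m arbitrary: P) auto

lemma iterated_eventually_conj:
  "iterated_eventually p n P \<Longrightarrow> iterated_eventually p n Q \<Longrightarrow> iterated_eventually p n (\<lambda>l. P l \<and> Q l)"
proof (induction n arbitrary: P Q)
  case (Suc n)
  have "\<forall>\<^sub>F v in p. iterated_eventually p n (\<lambda>l. P (v # l)) \<and> iterated_eventually p n (\<lambda>l. Q (v # l))"
    using Suc.prems by (simp add: eventually_conj)
  then show ?case unfolding iterated_eventually.simps by eventually_elim (simp add: Suc.IH)
qed simp

lemma iterated_eventually_ball:
  assumes "finite I" "\<And>i. i \<in> I \<Longrightarrow> iterated_eventually p n (P i)"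
  shows "iterated_eventually p n (\<lambda>l. \<forall>i\<in>I. P i l)"
  using assms(2)
proof (induction n arbitrary: P)
  case (Suc n)
  have "\<forall>\<^sub>F v in p. \<forall>i\<in>I. iterated_eventually p n (\<lambda>l. P i (v # l))"
    using Suc.prems by (intro eventually_ball_finite[OF assms(1)]) auto
  then show ?case
    by (auto elim!: eventually_mono intro!: Suc.IH)
qed simp

text \<open>Multiplication pushes the \<open>n\<close>-fold Fubini product of \<open>p\<close>
  forward to the \<open>n\<close>-th power of \<open>p\<close>, which is \<open>p\<close> by
  idempotency.\<close>

lemma iterated_eventually_prod_list:
  fixes p :: "'a::idom filter"
  assumes "ultra_mult p p = p"
  shows "n > 0 \<Longrightarrow> iterated_eventually p n (\<lambda>l. P (prod_list l)) \<longleftrightarrow> eventually P p"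
proof (induction n arbitrary: P)
  case (Suc n)
  show ?case
  proof (cases "n = 0")
    case False
    then have "iterated_eventually p (Suc n) (\<lambda>l. P (prod_list l)) \<longleftrightarrow> (\<forall>\<^sub>F v in p. \<forall>\<^sub>F x in p. P (v * x))"
      using Suc.IH[of "\<lambda>x. P (_ * x)"] by simp
    also have "\<dots> \<longleftrightarrow> eventually P p"
      using assms by (metis eventually_ultra_mult)
    finally show ?thesis .
  qed simp
qed simp

text \<open>Choose \<open>N\<close> elements successively generic for \<open>p\<close>. Let
  \<open>a i\<close> be the product of the tail from position \<open>i\<close>, and
  \<open>b i j\<close> the product of the block from \<open>i\<close> up to but excluding
  \<open>j\<close>. By idempotency each such product is again generic, and since the block
  \<open>b i j\<close> precedes the tail \<open>a j\<close>, the nested condition \<open>Q\<close>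
  applies to the pair.\<close>

lemma idempotent_product_pattern:
  fixes p :: "'a::idom filter"
  assumes p: "ultra_mult p p = p" "p \<noteq> bot"
    and R: "eventually R p" and Q: "\<forall>\<^sub>F b in p. \<forall>\<^sub>F a in p. Q b a"
  obtains a :: "nat \<Rightarrow> 'a" and b :: "nat \<Rightarrow> nat \<Rightarrow> 'a"
  where "\<And>i. i < N \<Longrightarrow> R (a i)"
    and "\<And>i j. i < j \<Longrightarrow> j < N \<Longrightarrow> a i = b i j * a j \<and> R (b i j) \<and> Q (b i j) (a j)"
proof -
  define a where "a l i = prod_list (drop i l)" for l :: "'a list" and i
  define b where "b l i j = prod_list (drop i (take j l))" for l :: "'a list" and i j
  define good where "good l \<longleftrightarrow> (\<forall>i\<in>{..<N}. R (a l i)) \<and>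
    (\<forall>ij\<in>{(i, j). i < j \<and> j < N}. R (b l (fst ij) (snd ij)) \<and> Q (b l (fst ij) (snd ij)) (a l (snd ij)))" for l
  have 1: "iterated_eventually p N (\<lambda>l. R (a l i))" if "i < N" for i
  proof -
    have N: "N = i + (N - i)" "N - i > 0" using that by auto
    have "iterated_eventually p i (\<lambda>l. iterated_eventually p (N - i) (\<lambda>l'. R (prod_list l')))"
      by (rule iterated_eventually_always) (simp add: iterated_eventually_prod_list[OF p(1) N(2)] R)
    then have "iterated_eventually p i (\<lambda>l. iterated_eventually p (N - i) (\<lambda>l'. R (a (l @ l') i)))"
      by (rule iterated_eventually_mono) (simp add: a_def)
    then show ?thesis by (subst N(1)) (simp only: iterated_eventually_append)
  qed
  have 2: "iterated_eventually p N (\<lambda>l. R (b l i j) \<and> Q (b l i j) (a l j))" if "i < j" "j < N" for i j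
  proof -
    \<comment> \<open>The list is cut at positions \<open>i\<close> and \<open>j\<close>. Block and
      tail are nonempty, as \<open>iterated_eventually_prod_list\<close> requires.\<close>
    have N: "N = i + ((j - i) + (N - j))" "j - i > 0" "N - j > 0" using that by auto
    have "\<forall>\<^sub>F x in p. R x \<and> (\<forall>\<^sub>F y in p. Q x y)" using R Q by (rule eventually_conj)
    then have "iterated_eventually p (j - i) (\<lambda>l'. R (prod_list l') \<and> (\<forall>\<^sub>F y in p. Q (prod_list l') y))"
      by (subst iterated_eventually_prod_list[OF p(1) N(2), of "\<lambda>x. R x \<and> (\<forall>\<^sub>F y in p. Q x y)"])
    then have "iterated_eventually p (j - i) (\<lambda>l'. iterated_eventually p (N - j)
        (\<lambda>l''. R (prod_list l') \<and> Q (prod_list l') (prod_list l'')))"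
    proof (rule iterated_eventually_mono)
      fix l' assume l': "R (prod_list l') \<and> (\<forall>\<^sub>F y in p. Q (prod_list l') y)"
      then have "iterated_eventually p (N - j) (\<lambda>l''. Q (prod_list l') (prod_list l''))"
        by (subst iterated_eventually_prod_list[OF p(1) N(3), of "Q (prod_list l')"]) simp
      then show "iterated_eventually p (N - j)
        (\<lambda>l''. R (prod_list l') \<and> Q (prod_list l') (prod_list l''))"
        by (rule iterated_eventually_mono) (use l' in simp)
    qed
    then have "iterated_eventually p i (\<lambda>l. iterated_eventually p (j - i) (\<lambda>l'. iterated_eventually p (N - j)
        (\<lambda>l''. R (prod_list l') \<and> Q (prod_list l') (prod_list l''))))"
      by (rule iterated_eventually_always)
    then have "iterated_eventually p i (\<lambda>l. iterated_eventually p (j - i) (\<lambda>l'. iterated_eventually p (N - j)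
        (\<lambda>l''. R (b (l @ l' @ l'') i j) \<and> Q (b (l @ l' @ l'') i j) (a (l @ l' @ l'') j))))"
    proof (rule iterated_eventually_mono)
      fix l :: "'a list" assume l: "length l = i" "iterated_eventually p (j - i) (\<lambda>l'. iterated_eventually p (N - j)
          (\<lambda>l''. R (prod_list l') \<and> Q (prod_list l') (prod_list l'')))"
      show "iterated_eventually p (j - i) (\<lambda>l'. iterated_eventually p (N - j)
          (\<lambda>l''. R (b (l @ l' @ l'') i j) \<and> Q (b (l @ l' @ l'') i j) (a (l @ l' @ l'') j)))"
        using l(2)
      proof (rule iterated_eventually_mono)
        fix l' :: "'a list" assume l': "length l' = j - i" "iterated_eventually p (N - j)
            (\<lambda>l''. R (prod_list l') \<and> Q (prod_list l') (prod_list l''))"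
        show "iterated_eventually p (N - j)
            (\<lambda>l''. R (b (l @ l' @ l'') i j) \<and> Q (b (l @ l' @ l'') i j) (a (l @ l' @ l'') j))"
          using l'(2)
          by (rule iterated_eventually_mono) (use l(1) l'(1) that in \<open>simp add: a_def b_def\<close>)
      qed
    qed
    then show ?thesis by (subst N(1)) (simp only: iterated_eventually_append)
  qed
  have "finite {(i, j). i < j \<and> j < N}"
    by (rule finite_subset[of _ "{..<N} \<times> {..<N}"]) auto
  then have "iterated_eventually p N (\<lambda>l. \<forall>ij\<in>{(i, j). i < j \<and> j < N}.
      R (b l (fst ij) (snd ij)) \<and> Q (b l (fst ij) (snd ij)) (a l (snd ij)))"
    using 2 by (intro iterated_eventually_ball) auto
  moreover have "iterated_eventually p N (\<lambda>l. \<forall>i\<in>{..<N}. R (a l i))"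
    using 1 by (intro iterated_eventually_ball) auto
  ultimately have "iterated_eventually p N good"
    unfolding good_def by (rule iterated_eventually_conj[rotated])
  then obtain l where l: "length l = N" "good l"
    using iterated_eventually_exists[OF p(2)] by blast
  have "a l i = b l i j * a l j" if "i < j" "j < N" for i j
  proof -
    have "drop i l = drop i (take j l) @ drop j l"
      using that l(1) by (metis append_take_drop_id drop_append drop_drop diff_is_0_eq' drop_0
          length_take less_imp_le min.absorb2 less_or_eq_imp_le)
    then show ?thesis by (simp add: a_def b_def)
  qed
  then show ?thesis
    using l(2) by (intro that[of "a l" "b l"]) (auto simp: good_def)
qed

section \<open>Semi-inner products and double limits\<close>

text \<open>The form is only semidefinite: nonzero vectors of norm zero are allowed, so that
  functions can be used without passing to classes modulo null sets.\<close>

locale semi_inner =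
  fixes ip :: "'v::real_vector \<Rightarrow> 'v \<Rightarrow> real"
  assumes ip_sym: "ip x y = ip y x"
    and ip_add_left: "ip (x + y) z = ip x z + ip y z"
    and ip_scale_left: "ip (r *\<^sub>R x) z = r * ip x z"
    and ip_nonneg: "ip x x \<ge> 0"
begin

lemma ip_add_right: "ip x (y + z) = ip x y + ip x z"
  using ip_add_left[of y z x] by (simp add: ip_sym)

lemma ip_scale_right: "ip x (r *\<^sub>R z) = r * ip x z"
  using ip_scale_left[of r z x] by (simp add: ip_sym)

lemma ip_diff_left: "ip (x - y) z = ip x z - ip y z"
  using ip_add_left[of "x - y" y z] by simp

lemma ip_diff_right: "ip x (y - z) = ip x y - ip x z"
  using ip_diff_left[of y z x] by (simp add: ip_sym)

lemma ip_zero_left: "ip 0 z = 0"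
  using ip_scale_left[of 0 0 z] by simp

lemma ip_sum_left: "ip (\<Sum>i\<in>I. y i) z = (\<Sum>i\<in>I. ip (y i) z)"
  by (induction I rule: infinite_finite_induct) (auto simp: ip_zero_left ip_add_left)

lemma ip_sum_right: "ip z (\<Sum>i\<in>I. y i) = (\<Sum>i\<in>I. ip z (y i))"
  using ip_sum_left[of y I z] by (simp add: ip_sym)

definition nrm :: "'v \<Rightarrow> real" where "nrm x = sqrt (ip x x)"

lemma nrm_nonneg: "nrm x \<ge> 0"
  by (simp add: nrm_def ip_nonneg)

lemma nrm_squared: "(nrm x)\<^sup>2 = ip x x"
  by (simp add: nrm_def ip_nonneg)

lemma ip_add_scale:
  "ip (x + t *\<^sub>R y) (x + t *\<^sub>R y) = ip x x + 2 * t * ip x y + t\<^sup>2 * ip y y"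
  by (simp add: ip_add_left ip_add_right ip_scale_left ip_scale_right ip_sym[of y x]
      power2_eq_square algebra_simps)

lemma Cauchy_Schwarz: "\<bar>ip x y\<bar> \<le> nrm x * nrm y"
proof -
  have "(ip x y)\<^sup>2 \<le> ip x x * ip y y"
    by (rule quadratic_nonneg_discriminant)
      (simp_all add: ip_nonneg ip_add_scale[symmetric])
  then have "\<bar>ip x y\<bar>\<^sup>2 \<le> (nrm x * nrm y)\<^sup>2"
    by (simp add: power_mult_distrib nrm_squared)
  then show ?thesis by (rule power2_le_imp_le) (simp add: nrm_nonneg)
qed

lemma nrm_triangle: "nrm (x + y) \<le> nrm x + nrm y"
proof -
  have "(nrm (x + y))\<^sup>2 \<le> (nrm x + nrm y)\<^sup>2"
    using Cauchy_Schwarz[of x y] ip_add_scale[of x 1 y]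
    by (simp add: nrm_squared power2_sum)
  then show ?thesis by (rule power2_le_imp_le) (simp add: nrm_nonneg)
qed

lemma nrm_triangle_diff: "nrm (x - y) \<le> nrm x + nrm y"
proof -
  have "nrm (- y) = nrm y"
    using ip_scale_left[of "-1" y] ip_scale_right[of _ "-1" y] by (simp add: nrm_def)
  then show ?thesis using nrm_triangle[of x "- y"] by simp
qed

text \<open>The inner product is not assumed complete; this replaces the Riesz representation theorem,
  so that weak limits are approximated in norm by vectors.\<close>

lemma approximate_Riesz:
  assumes add: "\<And>x y. \<phi> (x + y) = \<phi> x + \<phi> y" and scale: "\<And>r x. \<phi> (r *\<^sub>R x) = r * \<phi> x"
    and bdd: "\<And>x. \<bar>\<phi> x\<bar> \<le> C * nrm x" and C: "C \<ge> 0" and \<eta>: "\<eta> > 0"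
  obtains e where "\<And>x. \<bar>\<phi> x - ip e x\<bar> \<le> \<eta> * nrm x" "nrm e \<le> C + \<eta>"
proof -
  \<comment> \<open>An exact minimiser of \<open>J\<close> would be the representing vector. A point
    \<open>e\<close> whose value is within \<eta>^2 of the infimum suffices: comparing it with all
    \<open>e + t *\<^sub>R x\<close> and taking the discriminant bounds the error.\<close>
  define J where "J x = ip x x - 2 * \<phi> x" for x
  have below: "J x \<ge> - (C\<^sup>2)" for x
  proof -
    have "0 \<le> (nrm x - C)\<^sup>2" by simp
    then have "2 * (C * nrm x) \<le> ip x x + C\<^sup>2"
      by (simp add: power2_diff nrm_squared algebra_simps)
    then show ?thesis
      using bdd[of x] unfolding J_def by linarith
  qed
  define m where "m = (INF x. J x)"
  have bb: "bdd_below (range J)" using below by (intro bdd_belowI2[of _ "- (C\<^sup>2)"]) auto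
  have m_le: "m \<le> J x" for x unfolding m_def by (rule cINF_lower[OF bb]) simp
  have "m < m + \<eta>\<^sup>2" using \<eta> by simp
  then obtain e where e: "J e < m + \<eta>\<^sup>2"
    using cINF_less_iff[OF _ bb] unfolding m_def by blast
  have approx: "\<bar>\<phi> x - ip e x\<bar> \<le> \<eta> * nrm x" for x
  proof -
    have "\<eta>\<^sup>2 + 2 * t * (ip e x - \<phi> x) + t\<^sup>2 * ip x x \<ge> 0" for t
      using m_le[of "e + t *\<^sub>R x"] e
      by (simp add: J_def ip_add_scale add scale algebra_simps)
    then have "(ip e x - \<phi> x)\<^sup>2 \<le> \<eta>\<^sup>2 * ip x x"
      by (rule quadratic_nonneg_discriminant) (rule ip_nonneg)
    then have "\<bar>\<phi> x - ip e x\<bar>\<^sup>2 \<le> (\<eta> * nrm x)\<^sup>2"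
      by (simp add: power_mult_distrib nrm_squared power2_commute)
    then show ?thesis by (rule power2_le_imp_le) (use \<eta> in \<open>simp add: nrm_nonneg\<close>)
  qed
  have "nrm e \<le> C + \<eta>"
  proof (cases "nrm e = 0")
    case False
    have "nrm e * nrm e \<le> (C + \<eta>) * nrm e"
      using approx[of e] bdd[of e] nrm_squared[of e] by (simp add: power2_eq_square distrib_right)
    then show ?thesis using False nrm_nonneg[of e] by simp
  qed (use C \<eta> in simp)
  then show ?thesis using approx that by blast
qed

lemma Lim_ip_linear:
  fixes Y :: "'i \<Rightarrow> 'v"
  assumes r: "ultrafilter r" and Y: "\<And>w. nrm (Y w) \<le> D"
  defines "\<phi> \<equiv> \<lambda>x. Lim r (\<lambda>w. ip x (Y w))"
  shows "((\<lambda>w. ip x (Y w)) \<longlongrightarrow> \<phi> x) r" "\<bar>\<phi> x\<bar> \<le> D * nrm x"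
    "\<phi> (x + y) = \<phi> x + \<phi> y" "\<phi> (t *\<^sub>R x) = t * \<phi> x"
proof -
  have bdd: "\<bar>ip x (Y w)\<bar> \<le> D * nrm x" for x w
  proof -
    have "\<bar>ip x (Y w)\<bar> \<le> nrm x * nrm (Y w)" by (rule Cauchy_Schwarz)
    also have "\<dots> \<le> nrm x * D" by (intro mult_left_mono Y nrm_nonneg)
    finally show ?thesis by (simp add: mult.commute)
  qed
  have lim: "((\<lambda>w. ip x (Y w)) \<longlongrightarrow> \<phi> x) r" for x
    unfolding \<phi>_def by (rule ultrafilter_tendsto_Lim[OF r bdd])
  show "((\<lambda>w. ip x (Y w)) \<longlongrightarrow> \<phi> x) r" by (rule lim)
  show "\<bar>\<phi> x\<bar> \<le> D * nrm x" unfolding \<phi>_def by (rule abs_Lim_le[OF r bdd])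
  have uniq: "\<phi> z = l" if "((\<lambda>w. ip z (Y w)) \<longlongrightarrow> l) r" for z l
    using tendsto_unique[OF _ lim that] ultrafilter_not_bot[OF r] by auto
  show "\<phi> (x + y) = \<phi> x + \<phi> y"
    by (rule uniq) (simp add: ip_add_left tendsto_add[OF lim lim])
  show "\<phi> (t *\<^sub>R x) = t * \<phi> x"
    by (rule uniq) (simp add: ip_scale_left tendsto_mult_left[OF lim])
qed

text \<open>Grothendieck's double limit criterion. In a Hilbert space both sides are the inner
  product of the weak limits of \<open>X\<close> and \<open>Y\<close>. Here these weak limits are
  the functionals \<open>\<psi>\<close> and \<open>\<phi>\<close>, approximated by the vectors
  \<open>e'\<close> and \<open>e\<close>.\<close>

lemma double_limit_swap:
  assumes p: "ultrafilter p" and r: "ultrafilter r"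
    and X: "\<And>u. nrm (X u) \<le> C" and Y: "\<And>w. nrm (Y w) \<le> D"
  shows "Lim p (\<lambda>u. Lim r (\<lambda>w. ip (X u) (Y w))) = Lim r (\<lambda>w. Lim p (\<lambda>u. ip (X u) (Y w)))"
proof -
  define \<phi> where "\<phi> x = Lim r (\<lambda>w. ip x (Y w))" for x
  define \<psi> where "\<psi> y = Lim p (\<lambda>u. ip (X u) y)" for y
  have \<psi>_eq: "\<psi> y = Lim p (\<lambda>u. ip y (X u))" for y by (simp add: \<psi>_def ip_sym)
  note \<phi> = Lim_ip_linear[of r Y, OF r Y, folded \<phi>_def]
  note \<psi> = Lim_ip_linear[of p X, OF p X, folded \<psi>_eq]
  have C: "C \<ge> 0" using X nrm_nonneg order_trans by blast
  have D: "D \<ge> 0" using Y nrm_nonneg order_trans by blast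
  define a where "a = Lim p (\<lambda>u. \<phi> (X u))"
  define b where "b = Lim r (\<lambda>w. \<psi> (Y w))"
  have a: "((\<lambda>u. \<phi> (X u)) \<longlongrightarrow> a) p"
    unfolding a_def
  proof (rule ultrafilter_tendsto_Lim[OF p])
    show "\<bar>\<phi> (X u)\<bar> \<le> D * C" for u
      using \<phi>(2)[of "X u"] mult_left_mono[OF X D, of u] by linarith
  qed
  have b: "((\<lambda>w. \<psi> (Y w)) \<longlongrightarrow> b) r"
    unfolding b_def
  proof (rule ultrafilter_tendsto_Lim[OF r])
    show "\<bar>\<psi> (Y w)\<bar> \<le> C * D" for w
      using \<psi>(2)[of "Y w"] mult_left_mono[OF Y C, of w] by linarith
  qed
  have bound: "\<bar>a - b\<bar> \<le> \<eta> * (2 * C + 2 * D + 2)" if \<eta>: "0 < \<eta>" "\<eta> \<le> 1" for \<eta>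
  proof -
    obtain e where e: "\<And>x. \<bar>\<phi> x - ip e x\<bar> \<le> \<eta> * nrm x" "nrm e \<le> D + \<eta>"
      by (rule approximate_Riesz[of \<phi> D \<eta>]) (use \<phi> D \<eta> in auto)
    obtain e' where e': "\<And>x. \<bar>\<psi> x - ip e' x\<bar> \<le> \<eta> * nrm x" "nrm e' \<le> C + \<eta>"
      by (rule approximate_Riesz[of \<psi> C \<eta>]) (use \<psi> C \<eta> in auto)
    \<comment> \<open>The comparisons lead from \<open>a\<close> through \<open>\<psi> e\<close>,
      \<open>ip e e'\<close> and \<open>\<phi> e'\<close> to \<open>b\<close>.\<close>
    have "\<bar>a - \<psi> e\<bar> \<le> \<eta> * C"
    proof (rule abs_limit_diff_le[OF a \<psi>(1) ultrafilter_not_bot[OF p]])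
      show "\<bar>\<phi> (X u) - ip e (X u)\<bar> \<le> \<eta> * C" for u
        using e(1)[of "X u"] mult_left_mono[OF X, of \<eta> u] \<eta>(1) by linarith
    qed
    moreover have "\<bar>b - \<phi> e'\<bar> \<le> \<eta> * D"
    proof (rule abs_limit_diff_le[OF b \<phi>(1) ultrafilter_not_bot[OF r]])
      show "\<bar>\<psi> (Y u) - ip e' (Y u)\<bar> \<le> \<eta> * D" for u
        using e'(1)[of "Y u"] mult_left_mono[OF Y, of \<eta> u] \<eta>(1) by linarith
    qed
    moreover have "\<bar>\<phi> e' - ip e e'\<bar> \<le> \<eta> * (C + 1)"
      using e(1)[of e'] mult_left_mono[of "nrm e'" "C + 1" \<eta>] e'(2) \<eta> by linarith
    moreover have "\<bar>\<psi> e - ip e e'\<bar> \<le> \<eta> * (D + 1)"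
      using e'(1)[of e] mult_left_mono[of "nrm e" "D + 1" \<eta>] e(2) \<eta> ip_sym[of e' e] by linarith
    ultimately show ?thesis by (simp add: algebra_simps)
  qed
  have "a = b"
  proof (rule ccontr)
    define K where "K = 2 * C + 2 * D + 2"
    \<comment> \<open>With this choice the bound becomes at most half of
      \<open>\<bar>a - b\<bar>\<close>.\<close>
    define \<eta> where "\<eta> = min 1 (\<bar>a - b\<bar> / (2 * K))"
    assume "a \<noteq> b"
    moreover have K: "K > 0" using C D by (simp add: K_def)
    ultimately have "\<eta> > 0" "\<eta> \<le> 1" by (simp_all add: \<eta>_def)
    then have "\<bar>a - b\<bar> \<le> \<eta> * K" unfolding K_def by (rule bound)
    also have "\<dots> \<le> \<bar>a - b\<bar> / (2 * K) * K"
      using K by (intro mult_right_mono) (simp_all add: \<eta>_def)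
    also have "\<dots> = \<bar>a - b\<bar> / 2" using K by simp
    finally show False using \<open>a \<noteq> b\<close> by simp
  qed
  then show ?thesis by (simp add: a_def b_def \<phi>_def \<psi>_def)
qed

text \<open>The square expands into diagonal and off-diagonal terms, the latter symmetric in the two
  indices. The bound \<open>d\<close> may be negative, as in
  \<open>positive_definite_limit\<close>.\<close>

lemma ip_sum_le:
  fixes y :: "nat \<Rightarrow> 'v"
  assumes I: "finite I" and diag: "\<And>i. i \<in> I \<Longrightarrow> ip (y i) (y i) \<le> s"
    and off: "\<And>i j. i \<in> I \<Longrightarrow> j \<in> I \<Longrightarrow> i < j \<Longrightarrow> ip (y i) (y j) \<le> d"
  shows "ip (\<Sum>i\<in>I. y i) (\<Sum>i\<in>I. y i) \<le> real (card I) * (s + (real (card I) - 1) * d)"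
proof -
  have "ip (\<Sum>i\<in>I. y i) (\<Sum>i\<in>I. y i) = (\<Sum>i\<in>I. \<Sum>j\<in>I. ip (y i) (y j))"
    unfolding ip_sum_left by (simp only: ip_sum_right)
  also have "\<dots> \<le> (\<Sum>i\<in>I. \<Sum>j\<in>I. if j = i then s else d)"
  proof (intro sum_mono)
    fix i j assume "i \<in> I" "j \<in> I"
    then show "ip (y i) (y j) \<le> (if j = i then s else d)"
      using diag off[of i j] off[of j i] ip_sym[of "y i" "y j"] by (cases i j rule: linorder_cases) auto
  qed
  also have "\<dots> = (\<Sum>i\<in>I. s + (real (card I) - 1) * d)"
  proof (rule sum.cong[OF refl])
    fix i assume i: "i \<in> I"
    then have "card I \<ge> 1" using I by (metis One_nat_def Suc_leI card_gt_0_iff empty_iff)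
    have "(\<Sum>j\<in>I. if j = i then s else d) = s + (\<Sum>j\<in>I - {i}. if j = i then s else d)"
      using i I by (subst sum.remove[of _ i]) auto
    also have "(\<Sum>j\<in>I - {i}. if j = i then s else d) = (\<Sum>j\<in>I - {i}. d)"
      by (rule sum.cong) auto
    also have "\<dots> = (real (card I) - 1) * d"
      using i I \<open>card I \<ge> 1\<close> by (simp add: of_nat_diff)
    finally show "(\<Sum>j\<in>I. if j = i then s else d) = s + (real (card I) - 1) * d" .
  qed
  also have "\<dots> = real (card I) * (s + (real (card I) - 1) * d)" by simp
  finally show ?thesis .
qed

end

section \<open>Isometric actions of the affine semigroup\<close>

text \<open>Abstract Koopman operators, with \<open>e1\<close> for the constant function one.
  Composing functions with maps reverses products, which is why the affine relation takes the form
  \<open>A_M\<close>.\<close>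

locale affine_isometries = semi_inner ip for ip :: "'v::real_vector \<Rightarrow> 'v \<Rightarrow> real" +
  fixes A M :: "'a::idom \<Rightarrow> 'v \<Rightarrow> 'v" and e1 :: 'v
  assumes A_linear: "linear (A u)" and M_linear: "u \<noteq> 0 \<Longrightarrow> linear (M u)"
    and A_iso: "ip (A u x) (A u y) = ip x y"
    and M_iso: "u \<noteq> 0 \<Longrightarrow> ip (M u x) (M u y) = ip x y"
    and A_add: "A (u + w) x = A u (A w x)"
    and M_mult: "u \<noteq> 0 \<Longrightarrow> w \<noteq> 0 \<Longrightarrow> M (u * w) x = M u (M w x)"
    and A_M: "u \<noteq> 0 \<Longrightarrow> A w (M u x) = M u (A (u * w) x)"
    and A_e1: "A u e1 = e1" and M_e1: "u \<noteq> 0 \<Longrightarrow> M u e1 = e1"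
    and ip_e1: "ip e1 e1 = 1"
begin

lemma nrm_A: "nrm (A u x) = nrm x"
  by (simp add: nrm_def A_iso)

lemma nrm_M: "u \<noteq> 0 \<Longrightarrow> nrm (M u x) = nrm x"
  by (simp add: nrm_def M_iso)

lemma A_diff: "A u (x - y) = A u x - A u y"
  by (rule linear_diff[OF A_linear])

lemma M_diff: "u \<noteq> 0 \<Longrightarrow> M u (x - y) = M u x - M u y"
  by (rule linear_diff[OF M_linear])

text \<open>\<open>A 0\<close> need not be the identity, only an isometry absorbed by every \<open>A u\<close>.\<close>

lemma ip_A_shift: "ip (A u x) y = ip x (A (- u) y)"
proof -
  have "ip (A u x) y = ip (A (- u) (A u x)) (A (- u) y)" by (simp add: A_iso)
  also have "\<dots> = ip (A 0 x) (A 0 (A (- u) y))" by (simp flip: A_add)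
  also have "\<dots> = ip x (A (- u) y)" by (rule A_iso)
  finally show ?thesis .
qed

text \<open>The matrix coefficient of the weak limit of the operators \<open>A u\<close> along
  \<open>q\<close>. The limit operator is represented by this bilinear form, as its values need not
  be vectors of the space.\<close>

definition corr :: "'a filter \<Rightarrow> 'v \<Rightarrow> 'v \<Rightarrow> real" where
  "corr q x y = Lim q (\<lambda>u. ip (A u x) y)"

lemma ip_A_bound: "\<bar>ip (A u x) y\<bar> \<le> nrm x * nrm y"
  using Cauchy_Schwarz[of "A u x" y] by (simp add: nrm_A)

lemma corr_bound: "ultrafilter q \<Longrightarrow> \<bar>corr q x y\<bar> \<le> nrm x * nrm y"
  unfolding corr_def by (rule abs_Lim_le[OF _ ip_A_bound])

lemma corr_tendsto: "ultrafilter q \<Longrightarrow> ((\<lambda>u. ip (A u x) y) \<longlongrightarrow> corr q x y) q"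
  unfolding corr_def by (rule ultrafilter_tendsto_Lim[OF _ ip_A_bound])

lemma corr_ultra_add:
  assumes "ultrafilter p" "ultrafilter q"
  shows "corr (ultra_add p q) x y = Lim p (\<lambda>u. corr q x (A (- u) y))"
proof -
  have "ip (A (w + u) x) y = ip (A w x) (A (- u) y)" for u w
    by (simp add: add.commute[of w] A_add flip: ip_A_shift)
  then show ?thesis
    unfolding corr_def by (simp add: Lim_ultra_add[OF assms ip_A_bound])
qed

lemma corr_ultra_add_cong_right:
  assumes "ultrafilter p" "ultrafilter q" "ultrafilter q'" "corr q = corr q'"
  shows "corr (ultra_add p q) = corr (ultra_add p q')"
  using assms by (intro ext) (simp add: corr_ultra_add)

text \<open>Addition of ultrafilters is not commutative in general, but the operators
  \<open>A u\<close> commute and \<open>double_limit_swap\<close> interchanges the two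
  limits.\<close>

lemma corr_ultra_add_commute:
  assumes p: "ultrafilter p" and q: "ultrafilter q"
  shows "corr (ultra_add p q) = corr (ultra_add q p)"
proof (intro ext)
  fix x y
  have "corr (ultra_add p q) x y = Lim p (\<lambda>u. Lim q (\<lambda>w. ip (A w x) (A (- u) y)))"
    by (simp add: corr_ultra_add[OF p q]) (simp add: corr_def)
  also have "\<dots> = Lim p (\<lambda>u. Lim q (\<lambda>w. ip (A (- u) y) (A w x)))" by (simp add: ip_sym)
  also have "\<dots> = Lim q (\<lambda>w. Lim p (\<lambda>u. ip (A (- u) y) (A w x)))"
    by (rule double_limit_swap[OF p q, of _ "nrm y" _ "nrm x"]) (simp_all add: nrm_A)
  also have "\<dots> = Lim q (\<lambda>w. Lim p (\<lambda>u. ip (A u x) (A (- w) y)))"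
  proof -
    have "ip (A (- u) y) (A w x) = ip (A u x) (A (- w) y)" for u w
    proof -
      have "ip (A (- u) y) (A w x) = ip (A u (A w x)) y"
        using ip_A_shift[of u "A w x" y] ip_sym[of "A w x" "A (- u) y"] by simp
      also have "A u (A w x) = A w (A u x)" by (simp add: add.commute flip: A_add)
      finally show ?thesis by (simp only: ip_A_shift[of w])
    qed
    then show ?thesis by simp
  qed
  also have "\<dots> = corr (ultra_add q p) x y"
    by (simp add: corr_ultra_add[OF q p]) (simp add: corr_def)
  finally show "corr (ultra_add p q) x y = corr (ultra_add q p) x y" .
qed

text \<open>The classes of ultrafilters with equal \<open>corr\<close> form a commutative semigroup. Minimal idempotents
  are mapped into its smallest ideal, which contains a single idempotent.\<close>

lemma corr_AMI_absorb:
  assumes q: "q \<in> AMI" and q': "ultrafilter q'" "ultra_add q' q' = q'"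
  shows "corr (ultra_add q' q) = corr q"
proof -
  obtain Y where uf: "ultrafilter q" and Y: "uadd.minimal Y" "q \<in> Y"
    using q unfolding AMI_iff by blast
  obtain r where r: "ultrafilter r" "ultra_add r (ultra_add q' q) = q"
    using uadd.minimal_return[OF Y q'(1)] unfolding ultra_add_eq_op by auto
  note assoc = uadd.dot_assoc[folded ultra_add_eq_op]
  have uf_add: "ultrafilter (ultra_add a b)" if "ultrafilter a" "ultrafilter b" for a b :: "'a filter"
    using that unfolding ultra_add_eq_op by (rule ultrafilter_ultra_op)
  \<comment> \<open>Write \<open>q\<close> as the sum of \<open>r\<close>, \<open>q'\<close> and
    \<open>q\<close>. A further \<open>q'\<close> in front is moved, by commutativity up to
    \<open>corr\<close>, next to the one already present and merges with it.\<close>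
  have "corr (ultra_add q' q) = corr (ultra_add q' (ultra_add r (ultra_add q' q)))"
    by (simp add: r(2))
  also have "\<dots> = corr (ultra_add (ultra_add r (ultra_add q' q)) q')"
    by (rule corr_ultra_add_commute) (simp_all add: q'(1) r(2) uf)
  also have "\<dots> = corr (ultra_add r (ultra_add (ultra_add q' q) q'))"
    by (simp add: assoc)
  also have "\<dots> = corr (ultra_add r (ultra_add q' (ultra_add q' q)))"
    by (rule corr_ultra_add_cong_right)
      (simp_all add: r(1) q'(1) uf uf_add corr_ultra_add_commute)
  also have "ultra_add q' (ultra_add q' q) = ultra_add q' q"
    by (simp add: q'(2) flip: assoc)
  finally show ?thesis by (simp add: r(2))
qed

lemma corr_AMI_unique:
  assumes "q \<in> AMI" "q' \<in> AMI"
  shows "corr q = corr q'"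
proof -
  have "ultrafilter q" "ultrafilter q'" "ultra_add q q = q" "ultra_add q' q' = q'"
    using assms by (auto simp: AMI_iff)
  then show ?thesis
    using corr_AMI_absorb[OF assms(1), of q'] corr_AMI_absorb[OF assms(2), of q]
      corr_ultra_add_commute[of q q'] by simp
qed

end

section \<open>Recurrence along a DC ultrafilter\<close>

locale affine_isometries_DC = affine_isometries ip A M e1
  for ip :: "'v::real_vector \<Rightarrow> 'v \<Rightarrow> real" and A M :: "'a::idom \<Rightarrow> 'v \<Rightarrow> 'v" and e1 +
  fixes p :: "'a filter"
  assumes LID: "large_ideal_domain TYPE('a)" and p_DC: "p \<in> DC_ultrafilters"
begin

lemma p_ultrafilter: "ultrafilter p" and p_neq: "eventually (\<lambda>x. x \<noteq> u) p"
  and p_idem: "ultra_mult p p = p" and p_le: "p \<le> Sup AMI"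
proof -
  show uf: "ultrafilter p" using p_DC by (simp add: DC_ultrafilters_def MMI_def beta_star_def)
  have "nonprincipal p" using p_DC by (simp add: DC_ultrafilters_def MMI_def)
  then show "eventually (\<lambda>x. x \<noteq> u) p" using nonprincipal_iff[OF uf] by blast
  show "ultra_mult p p = p" using p_DC by (simp add: DC_ultrafilters_def MMI_def)
  have "p \<in> beta_topology closure_of AMI" using p_DC by (simp add: DC_ultrafilters_def)
  then show "p \<le> Sup AMI" by (subst (asm) in_beta_closure_iff) (simp_all add: AMI_iff)
qed

lemma p_not_bot: "p \<noteq> bot"
  using p_ultrafilter by (rule ultrafilter_not_bot)

text \<open>By \<open>corr_AMI_unique\<close> the choice does not affect
  \<open>corr q0\<close>.\<close>

definition q0 :: "'a filter" where "q0 = (SOME q. q \<in> AMI)"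

lemma q0_AMI: "q0 \<in> AMI"
proof -
  have "AMI \<noteq> ({} :: 'a filter set)"
  proof
    assume "AMI = ({} :: 'a filter set)"
    then show False using p_le p_not_bot by (simp add: bot_unique)
  qed
  then show ?thesis unfolding q0_def by (simp add: some_in_eq)
qed

lemma q0_ultrafilter: "ultrafilter q0"
  using q0_AMI by (simp add: AMI_iff)

text \<open>\<open>proj x y\<close> stands for the inner product of \<open>y\<close> with the projection of \<open>x\<close> to the almost periodic
  vectors of the additive action.\<close>

definition proj :: "'v \<Rightarrow> 'v \<Rightarrow> real" where "proj = corr q0"

text \<open>By \<open>AMI_dilate\<close> and \<open>corr_AMI_unique\<close> the dilated coefficients
  have the same limit along every member of \<open>AMI\<close>. Convergence then holds along
  \<open>Sup AMI\<close> and along every filter below it, in particular \<open>p\<close>.\<close>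

lemma proj_tendsto:
  assumes "c \<noteq> 0"
  shows "((\<lambda>u. ip (A (c * u) x) y) \<longlongrightarrow> proj x y) p"
proof -
  have "((\<lambda>u. ip (A (c * u) x) y) \<longlongrightarrow> proj x y) q" if "q \<in> AMI" for q
  proof -
    have "filtermap ((*) c) q \<in> AMI" by (rule AMI_dilate[OF LID that assms])
    then have "((\<lambda>u. ip (A u x) y) \<longlongrightarrow> proj x y) (filtermap ((*) c) q)"
      using corr_tendsto[of "filtermap ((*) c) q" x y] corr_AMI_unique[of _ q0, OF _ q0_AMI]
      by (simp add: proj_def AMI_iff)
    then show ?thesis by (simp add: filterlim_filtermap)
  qed
  then have "((\<lambda>u. ip (A (c * u) x) y) \<longlongrightarrow> proj x y) (Sup AMI)"
    unfolding tendsto_iff eventually_Sup by blast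
  then show ?thesis by (rule tendsto_mono[OF p_le])
qed

lemma proj_tendsto_1: "((\<lambda>u. ip (A u x) y) \<longlongrightarrow> proj x y) p"
  using proj_tendsto[of 1] by simp

lemma proj_bound: "\<bar>proj x y\<bar> \<le> nrm x * nrm y"
  unfolding proj_def using q0_ultrafilter by (rule corr_bound)

lemma proj_unique: "((\<lambda>u. ip (A u x) y) \<longlongrightarrow> l) p \<Longrightarrow> proj x y = l"
  using tendsto_unique[OF p_not_bot proj_tendsto_1] by blast

lemma proj_diff_left: "proj (x - y) z = proj x z - proj y z"
  by (rule proj_unique) (simp add: A_diff ip_diff_left tendsto_diff proj_tendsto_1)

lemma proj_add_right: "proj x (y + z) = proj x y + proj x z"
  by (rule proj_unique) (simp add: ip_add_right tendsto_add proj_tendsto_1)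

lemma proj_scale_right: "proj x (t *\<^sub>R z) = t * proj x z"
  by (rule proj_unique) (simp add: ip_scale_right tendsto_mult_left proj_tendsto_1)

lemma proj_e1: "proj x e1 = ip x e1"
proof (rule proj_unique)
  have "ip (A u x) e1 = ip x e1" for u using A_iso[of u x e1] by (simp add: A_e1)
  then show "((\<lambda>u. ip (A u x) e1) \<longlongrightarrow> ip x e1) p" by simp
qed

text \<open>The approximate form of V V = V, with \<open>g\<close> standing for V f. Idempotency of
  \<open>q0\<close> makes \<open>proj f k\<close> the limit of \<open>proj f (A (- u) k)\<close>,
  and there \<open>proj f\<close> may be replaced by \<open>ip g\<close> at cost \<eta>.\<close>

lemma proj_approx_idem:
  assumes g: "\<And>x. \<bar>proj f x - ip g x\<bar> \<le> \<eta> * nrm x"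
  shows "\<bar>proj f k - proj g k\<bar> \<le> \<eta> * nrm k"
proof -
  have idem: "ultra_add q0 q0 = q0" using q0_AMI by (simp add: AMI_iff)
  have "((\<lambda>u. proj f (A (- u) k)) \<longlongrightarrow> Lim q0 (\<lambda>u. proj f (A (- u) k))) q0"
  proof (rule ultrafilter_tendsto_Lim[OF q0_ultrafilter])
    show "\<bar>proj f (A (- u) k)\<bar> \<le> nrm f * nrm k" for u
      using proj_bound[of f "A (- u) k"] by (simp add: nrm_A)
  qed
  also have "Lim q0 (\<lambda>u. proj f (A (- u) k)) = proj f k"
    unfolding proj_def using corr_ultra_add[OF q0_ultrafilter q0_ultrafilter, of f k]
    by (simp add: idem)
  finally have 1: "((\<lambda>u. proj f (A (- u) k)) \<longlongrightarrow> proj f k) q0" .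
  have "((\<lambda>u. ip (A u g) k) \<longlongrightarrow> proj g k) q0"
    unfolding proj_def using q0_ultrafilter by (rule corr_tendsto)
  then have 2: "((\<lambda>u. ip g (A (- u) k)) \<longlongrightarrow> proj g k) q0" by (simp add: ip_A_shift)
  show ?thesis
    by (rule abs_limit_diff_le[OF 1 2 ultrafilter_not_bot[OF q0_ultrafilter]])
      (use g nrm_A in \<open>metis\<close>)
qed

text \<open>A failure would occur with one fixed sign along \<open>p\<close>. The product pattern
  then gives vectors \<open>y i\<close> whose signed inner products with the single vector
  \<open>F\<close> all exceed \<open>l\<close>, while their mutual inner products are at most
  \<open>d\<close>. Their sum has norm at least N l but squared norm at most N |h|^2 + N^2 d, which
  is impossible for large \<open>N\<close>.\<close>

lemma van_der_Corput:
  assumes small: "\<forall>\<^sub>F b in p. \<forall>\<^sub>F a in p. \<bar>ip (M b (A a h)) (A (a * b) h)\<bar> \<le> d"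
    and f: "nrm f \<le> 1" and l: "l\<^sup>2 > d" "l \<ge> 0"
  shows "\<forall>\<^sub>F u in p. \<bar>ip (A u h) (M u f)\<bar> \<le> l"
proof (rule ccontr)
  assume "\<not> ?thesis"
  then have "\<forall>\<^sub>F u in p. \<not> (\<bar>ip (A u h) (M u f)\<bar> \<le> l)"
    using ultrafilter_eventually_cases[OF p_ultrafilter] by blast
  then have "\<forall>\<^sub>F u in p. 1 * ip (A u h) (M u f) > l \<or> (-1) * ip (A u h) (M u f) > l"
    by eventually_elim auto
  then have "(\<forall>\<^sub>F u in p. 1 * ip (A u h) (M u f) > l) \<or> (\<forall>\<^sub>F u in p. (-1) * ip (A u h) (M u f) > l)"
    by (rule ultrafilter_eventually_disj[OF p_ultrafilter])
  then obtain \<sigma> :: real where \<sigma>: "\<bar>\<sigma>\<bar> = 1" "\<forall>\<^sub>F u in p. \<sigma> * ip (A u h) (M u f) > l"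
    by (metis abs_1 abs_minus_cancel)
  obtain N :: nat where N: "real N > max 1 (ip h h / (l\<^sup>2 - d))"
    using reals_Archimedean2 by blast
  have R: "\<forall>\<^sub>F u in p. u \<noteq> 0 \<and> \<sigma> * ip (A u h) (M u f) > l"
    using p_neq \<sigma>(2) by (rule eventually_conj)
  \<comment> \<open>There are \<open>N + 1\<close> indices: index 0 supplies the common vector
    \<open>F\<close>, and the indices from 1 to \<open>N\<close> supply the
    \<open>y i\<close>.\<close>
  obtain a b where
    a: "\<And>i. i < N + 1 \<Longrightarrow> a i \<noteq> 0 \<and> \<sigma> * ip (A (a i) h) (M (a i) f) > l"
    and b: "\<And>i j. i < j \<Longrightarrow> j < N + 1 \<Longrightarrow> a i = b i j * a j \<and>
      (b i j \<noteq> 0 \<and> \<sigma> * ip (A (b i j) h) (M (b i j) f) > l) \<and>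
      \<bar>ip (M (b i j) (A (a j) h)) (A (a j * b i j) h)\<bar> \<le> d"
    by (rule idempotent_product_pattern[OF p_idem p_not_bot R small, of "N + 1"]) blast
  define y where "y i = M (b 0 i) (A (a i) h)" for i
  define F where "F = M (a 0) f"
  have yF: "\<sigma> * ip (y i) F > l" if "i \<in> {1..N}" for i
  proof -
    have i: "0 < i" "i < N + 1" using that by auto
    have "F = M (b 0 i) (M (a i) f)"
      using b[OF i] a[OF i(2)] by (simp add: F_def M_mult)
    then have "ip (y i) F = ip (A (a i) h) (M (a i) f)"
      using b[OF i] by (simp add: y_def M_iso)
    then show ?thesis using a[OF i(2)] by simp
  qed
  have yy: "ip (y i) (y j) \<le> d" if "i \<in> {1..N}" "j \<in> {1..N}" "i < j" for i j
  proof -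
    have i: "0 < i" "i < N + 1" and j: "0 < j" "j < N + 1" using that by auto
    \<comment> \<open>Both sides equal \<open>a 0\<close>; cancelling \<open>a j\<close> shows that
      adjacent blocks multiply.\<close>
    have "b 0 j * a j = b 0 i * b i j * a j"
      using b[OF i] b[OF j] b[OF that(3) j(2)] by (metis mult.assoc)
    then have "b 0 j = b 0 i * b i j" using a[OF j(2)] by simp
    then have "y j = M (b 0 i) (M (b i j) (A (a j) h))"
      using b[OF i] b[OF that(3) j(2)] by (simp add: y_def M_mult)
    then have "ip (y i) (y j) = ip (A (a i) h) (M (b i j) (A (a j) h))"
      using b[OF i] by (simp add: y_def M_iso)
    also have "\<dots> = ip (M (b i j) (A (a j) h)) (A (a j * b i j) h)"
      using b[OF that(3) j(2)] by (simp add: ip_sym mult.commute)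
    finally show ?thesis using b[OF that(3) j(2)] by linarith
  qed
  have yd: "ip (y i) (y i) \<le> ip h h" if "i \<in> {1..N}" for i
    using b[of 0 i] that by (simp add: y_def M_iso A_iso)
  define Y where "Y = (\<Sum>i\<in>{1..N}. y i)"
  have d: "d \<ge> 0"
  proof -
    obtain b' where "\<forall>\<^sub>F a in p. \<bar>ip (M b' (A a h)) (A (a * b') h)\<bar> \<le> d"
      using small eventually_happens p_not_bot by blast
    then obtain a' where "\<bar>ip (M b' (A a' h)) (A (a' * b') h)\<bar> \<le> d"
      using eventually_happens p_not_bot by blast
    then show ?thesis by linarith
  qed
  have "real N * l \<le> (\<Sum>i\<in>{1..N}. \<sigma> * ip (y i) F)"
    using sum_mono[of "{1..N}" "\<lambda>_. l" "\<lambda>i. \<sigma> * ip (y i) F"] yF by (simp add: less_imp_le)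
  also have "\<dots> = \<sigma> * ip Y F" by (simp add: Y_def ip_sum_left sum_distrib_left)
  also have "\<dots> \<le> \<bar>ip Y F\<bar>" using \<sigma>(1) by (metis abs_ge_self abs_mult mult_1)
  also have "\<dots> \<le> nrm Y * nrm F" by (rule Cauchy_Schwarz)
  also have "\<dots> \<le> nrm Y * 1"
    using f a[of 0] by (intro mult_left_mono nrm_nonneg) (simp add: F_def nrm_M)
  finally have "real N * l \<le> nrm Y" by simp
  then have "(real N * l)\<^sup>2 \<le> (nrm Y)\<^sup>2" using l(2) by (intro power_mono) auto
  also have "\<dots> = ip Y Y" by (rule nrm_squared)
  also have "\<dots> \<le> real (card {1..N}) * (ip h h + (real (card {1..N}) - 1) * d)"
    unfolding Y_def by (rule ip_sum_le) (use yy yd in auto)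
  also have "\<dots> \<le> real N * (ip h h + real N * d)"
  proof -
    have "(real N - 1) * d \<le> real N * d" using d by (simp add: mult_right_mono)
    then show ?thesis by (simp add: mult_left_mono)
  qed
  finally have "real N * (real N * l\<^sup>2) \<le> real N * (ip h h + real N * d)"
    by (simp add: power_mult_distrib power2_eq_square algebra_simps)
  then have "real N * l\<^sup>2 \<le> ip h h + real N * d" using N by simp
  then have "real N * (l\<^sup>2 - d) \<le> ip h h" by (simp add: algebra_simps)
  moreover have "ip h h < real N * (l\<^sup>2 - d)"
    using N l(1) by (simp add: pos_divide_less_eq)
  ultimately show False by simp
qed

text \<open>On a product pattern the vectors \<open>y i\<close> have pairwise inner products
  \<open>ip (M (b i j) x) x\<close>. Were all of these below \<open>- \<epsilon>\<close>, the
  squared norm of the sum of \<open>N\<close> such vectors would be negative for large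
  \<open>N\<close>.\<close>

lemma positive_definite_limit:
  assumes "\<epsilon> > 0"
  shows "\<forall>\<^sub>F u in p. ip x (M u x) \<ge> - \<epsilon>"
proof (rule ccontr)
  assume "\<not> ?thesis"
  then have "\<forall>\<^sub>F u in p. \<not> (ip x (M u x) \<ge> - \<epsilon>)"
    using ultrafilter_eventually_cases[OF p_ultrafilter] by blast
  then have R: "\<forall>\<^sub>F u in p. u \<noteq> 0 \<and> ip x (M u x) < - \<epsilon>"
    by (auto simp: not_le eventually_conj p_neq)
  obtain N :: nat where N: "real N > max 1 (ip x x / \<epsilon> + 1)"
    using reals_Archimedean2 by blast
  have Q: "\<forall>\<^sub>F b in p. \<forall>\<^sub>F a in p. True" by simp
  obtain a b where
    a: "\<And>i. i < N \<Longrightarrow> a i \<noteq> 0 \<and> ip x (M (a i) x) < - \<epsilon>"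
    and b: "\<And>i j. i < j \<Longrightarrow> j < N \<Longrightarrow> a i = b i j * a j \<and>
      (b i j \<noteq> 0 \<and> ip x (M (b i j) x) < - \<epsilon>) \<and> True"
    by (rule idempotent_product_pattern[OF p_idem p_not_bot R Q, of N]) blast
  define y where "y i = M (a i) x" for i
  define Y where "Y = (\<Sum>i\<in>{..<N}. y i)"
  have "ip Y Y \<le> real (card {..<N}) * (ip x x + (real (card {..<N}) - 1) * (- \<epsilon>))"
    unfolding Y_def
  proof (rule ip_sum_le)
    fix i j assume ij: "i \<in> {..<N}" "j \<in> {..<N}" "i < j"
    then have "y i = M (a j) (M (b i j) x)"
      using a[of j] b[of i j] by (simp add: y_def M_mult mult.commute[of "b i j"])
    then have "ip (y i) (y j) = ip (M (b i j) x) x"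
      using a[of j] ij by (simp add: y_def M_iso)
    then show "ip (y i) (y j) \<le> - \<epsilon>"
      using b[of i j] ij by (simp add: ip_sym less_imp_le)
  qed (use a in \<open>auto simp: y_def M_iso\<close>)
  then have "0 \<le> real N * (ip x x + (real N - 1) * (- \<epsilon>))"
    using ip_nonneg[of Y] by simp
  then have "0 \<le> ip x x + (real N - 1) * (- \<epsilon>)"
    using N by (simp add: zero_le_mult_iff)
  moreover have "ip x x / \<epsilon> < real N - 1" using N by simp
  then have "ip x x < (real N - 1) * \<epsilon>" using assms by (simp add: pos_divide_less_eq)
  ultimately show False by simp
qed

text \<open>The adjoint of \<open>M b\<close> applied to \<open>z\<close> is approximated by a
  vector \<open>e\<close>. The quantity is then close to the inner product of
  \<open>A (c * a) h\<close> with \<open>e\<close>, whose limit \<open>proj h e\<close> is small by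
  hypothesis.\<close>

lemma ip_M_A_small:
  assumes h: "\<And>k. \<bar>proj h k\<bar> \<le> \<eta> * nrm k" "nrm h \<le> 3" and \<eta>: "0 < \<eta>" "\<eta> \<le> 1"
    and b: "b \<noteq> 0" and c: "c \<noteq> 0" and z: "nrm z \<le> 3"
  shows "\<forall>\<^sub>F a in p. \<bar>ip (M b (A (c * a) h)) z\<bar> \<le> 8 * \<eta>"
proof -
  interpret Mb: linear "M b" by (rule M_linear[OF b])
  have "\<bar>ip (M b x) z\<bar> \<le> 3 * nrm x" for x
  proof -
    have "\<bar>ip (M b x) z\<bar> \<le> nrm x * nrm z"
      using Cauchy_Schwarz[of "M b x" z] by (simp add: nrm_M[OF b])
    also have "\<dots> \<le> nrm x * 3" by (intro mult_left_mono z nrm_nonneg)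
    finally show ?thesis by (simp add: mult.commute)
  qed
  then obtain e where e: "\<And>x. \<bar>ip (M b x) z - ip e x\<bar> \<le> \<eta> * nrm x" "nrm e \<le> 3 + \<eta>"
    using approximate_Riesz[of "\<lambda>x. ip (M b x) z" 3 \<eta>] \<eta>(1)
    by (auto simp: Mb.add Mb.scale ip_add_left ip_scale_left)
  \<comment> \<open>The limit is at most 4 \<eta>, so the strict bound 5 \<eta> holds eventually;
    the error of the representation adds 3 \<eta>.\<close>
  have "\<eta> * nrm e \<le> \<eta> * 4" using e(2) \<eta> by (intro mult_left_mono) auto
  then have "\<bar>proj h e\<bar> < 5 * \<eta>" using h(1)[of e] \<eta>(1) by linarith
  with tendsto_rabs[OF proj_tendsto[OF c]] have "\<forall>\<^sub>F a in p. \<bar>ip (A (c * a) h) e\<bar> < 5 * \<eta>"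
    by (rule order_tendstoD(2))
  then show ?thesis
  proof eventually_elim
    fix a assume a: "\<bar>ip (A (c * a) h) e\<bar> < 5 * \<eta>"
    have "\<eta> * nrm (A (c * a) h) \<le> \<eta> * 3" using h(2) \<eta>(1) by (simp add: nrm_A)
    then show "\<bar>ip (M b (A (c * a) h)) z\<bar> \<le> 8 * \<eta>"
      using e(1)[of "A (c * a) h"] a ip_sym[of e "A (c * a) h"] by linarith
  qed
qed

lemma recurrence:
  assumes f: "nrm f \<le> 1" and \<epsilon>: "\<epsilon> > 0"
  shows "\<forall>\<^sub>F u in p. ip (A u f) (M u f) \<ge> (ip f e1)\<^sup>2 - \<epsilon>"
proof -
  \<comment> \<open>The errors collected below are 4 \<delta>, 3 \<delta>, 11 \<eta>, 2 \<eta> and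
    \<eta>, in total at most 21 \<delta>. Taking \<eta> to be \<delta>^2 serves the two estimates
    that involve a square root.\<close>
  define \<delta> where "\<delta> = min 1 (\<epsilon> / 21)"
  define \<eta> where "\<eta> = \<delta>\<^sup>2"
  have \<delta>: "0 < \<delta>" "\<delta> \<le> 1" "21 * \<delta> \<le> \<epsilon>" using \<epsilon> by (auto simp: \<delta>_def)
  have "\<delta> * \<delta> \<le> \<delta> * 1" using \<delta> by (intro mult_left_mono) auto
  then have \<eta>: "0 < \<eta>" "\<eta> \<le> \<delta>" using \<delta>(1) by (simp_all add: \<eta>_def power2_eq_square)
  then have \<eta>1: "\<eta> \<le> 1" using \<delta>(2) by simp
  have "\<bar>proj f x\<bar> \<le> 1 * nrm x" for x
    using proj_bound[of f x] mult_right_mono[OF f nrm_nonneg, of x] by linarith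
  \<comment> \<open>\<open>g\<close> is a vector standing for V f, so the projection of
    \<open>f - g\<close> is small.\<close>
  then obtain g where g: "\<And>x. \<bar>proj f x - ip g x\<bar> \<le> \<eta> * nrm x" "nrm g \<le> 1 + \<eta>"
    using approximate_Riesz[of "proj f" 1 \<eta>] \<eta>(1)
    by (auto simp: proj_add_right proj_scale_right)
  have g2: "nrm g \<le> 2" using g(2) \<eta>1 by simp
  define h where "h = f - g"
  have h3: "nrm h \<le> 3" using nrm_triangle_diff[of f g] f g2 by (simp add: h_def)
  have ph: "\<bar>proj h k\<bar> \<le> \<eta> * nrm k" for k
    unfolding h_def proj_diff_left using g(1) by (rule proj_approx_idem)
  note small = ip_M_A_small[OF ph h3 \<eta>(1) \<eta>1]

  \<comment> \<open>Excluding the solutions of b^2 = 1 makes 1 - b^2 an admissible dilation factor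
    in \<open>small\<close>.\<close>
  have "\<forall>\<^sub>F b in p. b \<noteq> 0 \<and> b \<noteq> 1 \<and> b \<noteq> - 1"
    by (intro eventually_conj p_neq)
  then have "\<forall>\<^sub>F b in p. \<forall>\<^sub>F a in p. \<bar>ip (M b (A a h)) (A (a * b) h)\<bar> \<le> 8 * \<eta>"
  proof eventually_elim
    fix b :: 'a assume b: "b \<noteq> 0 \<and> b \<noteq> 1 \<and> b \<noteq> - 1"
    then have "1 - b * b \<noteq> 0" by (simp add: square_eq_1_iff)
    then have ev: "\<forall>\<^sub>F a in p. \<bar>ip (M b (A ((1 - b * b) * a) h)) h\<bar> \<le> 8 * \<eta>"
      using b h3 by (intro small) auto
    \<comment> \<open>Shift \<open>A (a * b)\<close> to the other argument and carry it through
      \<open>M b\<close>; the two translations merge into one.\<close>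
    have "ip (M b (A a h)) (A (a * b) h) = ip (M b (A ((1 - b * b) * a) h)) h" for a
    proof -
      have "ip (M b (A a h)) (A (a * b) h) = ip (A (- (a * b)) (M b (A a h))) h"
        by (simp add: ip_A_shift[of "- (a * b)"])
      also have "A (- (a * b)) (M b (A a h)) = M b (A (b * - (a * b)) (A a h))"
        using b by (intro A_M) simp
      also have "\<dots> = M b (A (b * - (a * b) + a) h)" by (subst A_add) (rule refl)
      also have "b * - (a * b) + a = (1 - b * b) * a" by (simp add: algebra_simps)
      finally show ?thesis .
    qed
    then show "\<forall>\<^sub>F a in p. \<bar>ip (M b (A a h)) (A (a * b) h)\<bar> \<le> 8 * \<eta>" using ev by simp
  qed
  then have ev1: "\<forall>\<^sub>F u in p. \<bar>ip (A u h) (M u f)\<bar> \<le> 4 * \<delta>"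
    by (rule van_der_Corput[OF _ f]) (use \<delta> in \<open>simp_all add: \<eta>_def power_mult_distrib\<close>)

  have \<eta>g: "\<eta> * nrm g \<le> \<eta> * 2" using g2 \<eta>(1) by simp
  \<comment> \<open>The projection fixes \<open>g\<close> up to an error of 4 \<eta>. The slightly
    larger 9/2 \<eta> doubles to 9 \<eta>, which is the square of 3 \<delta>.\<close>
  have "proj g g > ip g g - 9 / 2 * \<eta>"
    using g(1)[of g] proj_approx_idem[OF g(1), of g] \<eta>g \<eta>(1) by linarith
  with proj_tendsto_1 have "\<forall>\<^sub>F u in p. ip (A u g) g > ip g g - 9 / 2 * \<eta>"
    by (rule order_tendstoD(1))
  then have ev2: "\<forall>\<^sub>F u in p. nrm (A u g - g) \<le> 3 * \<delta>"
  proof eventually_elim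
    fix u assume u: "ip (A u g) g > ip g g - 9 / 2 * \<eta>"
    have "(nrm (A u g - g))\<^sup>2 = 2 * ip g g - 2 * ip (A u g) g"
      by (simp add: nrm_squared ip_diff_left ip_diff_right A_iso ip_sym[of g "A u g"])
    also have "\<dots> \<le> (3 * \<delta>)\<^sup>2" using u by (simp add: \<eta>_def power_mult_distrib)
    finally show "nrm (A u g - g) \<le> 3 * \<delta>"
      by (rule power2_le_imp_le) (use \<delta>(1) in simp)
  qed

  \<comment> \<open>V f is nearly orthogonal to \<open>M u h\<close>: moving \<open>A w\<close>
    across and through \<open>M u\<close> leaves a dilated translate of \<open>h\<close>, to which
    \<open>small\<close> applies.\<close>
  have ev3: "\<bar>ip g (M u h)\<bar> \<le> 11 * \<eta>" if u: "u \<noteq> 0" for u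
  proof -
    have "ip (A w f) (M u h) = ip (M u (A (- u * w) h)) f" for w
    proof -
      have "ip (A w f) (M u h) = ip f (A (- w) (M u h))" by (rule ip_A_shift)
      also have "A (- w) (M u h) = M u (A (- u * w) h)" by (simp add: A_M[OF u])
      finally show ?thesis by (simp add: ip_sym)
    qed
    then have "\<forall>\<^sub>F w in p. \<bar>ip (A w f) (M u h)\<bar> \<le> 8 * \<eta>"
      using small[of u "- u" f] u f by simp
    then have "\<bar>proj f (M u h)\<bar> \<le> 8 * \<eta>"
      by (rule tendsto_upperbound[OF tendsto_rabs[OF proj_tendsto_1] _ p_not_bot])
    moreover have "\<eta> * nrm (M u h) \<le> \<eta> * 3" using h3 \<eta>(1) by (simp add: nrm_M[OF u])
    ultimately show ?thesis using g(1)[of "M u h"] by linarith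
  qed

  \<comment> \<open>The mean is split off: the constant part contributes exactly
    \<open>m\<^sup>2\<close>, and \<open>positive_definite_limit\<close> bounds the contribution of
    the remainder \<open>g'\<close> from below.\<close>
  define m where "m = ip g e1"
  define g' where "g' = g - m *\<^sub>R e1"
  have M_g: "ip g (M u g) = m\<^sup>2 + ip g' (M u g')" if u: "u \<noteq> 0" for u
  proof -
    have Mg': "M u g' = M u g - m *\<^sub>R e1"
      by (simp add: g'_def M_diff[OF u] linear_scale[OF M_linear[OF u]] M_e1[OF u])
    have "ip e1 (M u g) = m"
      using M_iso[OF u, of e1 g] by (simp add: M_e1[OF u] m_def ip_sym)
    then show ?thesis
      unfolding Mg'
      by (simp add: g'_def ip_diff_left ip_diff_right ip_scale_left ip_scale_right ip_e1
          m_def[symmetric] power2_eq_square)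
  qed
  have "(ip f e1)\<^sup>2 - 2 * \<eta> \<le> m\<^sup>2"
  proof -
    have "nrm e1 = 1" by (simp add: nrm_def ip_e1)
    then have d: "\<bar>ip f e1 - m\<bar> \<le> \<eta>" using g(1)[of e1] by (simp add: proj_e1 m_def)
    have "\<bar>ip f e1\<bar> \<le> 1" using Cauchy_Schwarz[of f e1] f \<open>nrm e1 = 1\<close> by simp
    then have "\<bar>ip f e1\<bar> * \<bar>ip f e1 - m\<bar> \<le> 1 * \<eta>" using d by (intro mult_mono) auto
    then have "ip f e1 * (ip f e1 - m) \<le> \<eta>" by (simp flip: abs_mult)
    moreover have "0 \<le> (ip f e1 - m)\<^sup>2" by simp
    ultimately show ?thesis by (simp add: power2_eq_square algebra_simps)
  qed
  note m = this

  from ev1 ev2 p_neq[of 0] positive_definite_limit[OF \<eta>(1), of g'] show ?thesis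
  proof eventually_elim
    fix u assume u: "\<bar>ip (A u h) (M u f)\<bar> \<le> 4 * \<delta>" "nrm (A u g - g) \<le> 3 * \<delta>" "u \<noteq> 0"
      "- \<eta> \<le> ip g' (M u g')"
    have "ip (A u f) (M u f) = ip (A u h) (M u f) + ip (A u g - g) (M u f) + ip g (M u h) + ip g (M u g)"
      by (simp add: h_def A_diff M_diff[OF u(3)] ip_diff_left ip_diff_right)
    moreover have "\<bar>ip (A u g - g) (M u f)\<bar> \<le> 3 * \<delta>"
    proof -
      have "nrm (A u g - g) * nrm (M u f) \<le> 3 * \<delta> * 1"
        using u(2) f \<delta>(1) by (intro mult_mono) (auto simp: nrm_M[OF u(3)] nrm_nonneg)
      then show ?thesis using Cauchy_Schwarz[of "A u g - g" "M u f"] by linarith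
    qed
    ultimately show "(ip f e1)\<^sup>2 - \<epsilon> \<le> ip (A u f) (M u f)"
      using u(1,4) ev3[OF u(3)] M_g[OF u(3)] m \<eta>(2) \<delta>(3) by linarith
  qed
qed

end

section \<open>The Koopman representation\<close>

instantiation "fun" :: (type, real_vector) real_vector
begin

definition scaleR_fun :: "real \<Rightarrow> ('a \<Rightarrow> 'b) \<Rightarrow> 'a \<Rightarrow> 'b" where
  "scaleR_fun r f = (\<lambda>x. r *\<^sub>R f x)"

instance
  by standard (auto simp: scaleR_fun_def fun_eq_iff scaleR_add_right scaleR_add_left)

end

text \<open>Boundedness makes products integrable. Vanishing off \<open>space \<mu>\<close> lets the
  identities between pullbacks hold as equations of functions rather than almost everywhere.\<close>

definition bounded_measurable :: "'w measure \<Rightarrow> ('w \<Rightarrow> real) set" where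
  "bounded_measurable \<mu> =
     {x \<in> borel_measurable \<mu>. (\<exists>C. \<forall>\<omega>. \<bar>x \<omega>\<bar> \<le> C) \<and> (\<forall>\<omega>. \<omega> \<notin> space \<mu> \<longrightarrow> x \<omega> = 0)}"

lemma subspace_bounded_measurable: "subspace (bounded_measurable \<mu>)"
  unfolding subspace_def
proof (intro conjI ballI allI)
  show "0 \<in> bounded_measurable \<mu>"
    by (auto simp: bounded_measurable_def zero_fun_def intro: exI[of _ 0])
  fix x assume x: "x \<in> bounded_measurable \<mu>"
  then obtain C where C: "\<And>\<omega>. \<bar>x \<omega>\<bar> \<le> C" by (auto simp: bounded_measurable_def)
  show "r *\<^sub>R x \<in> bounded_measurable \<mu>" for r
    using x C by (auto simp: bounded_measurable_def scaleR_fun_def abs_mult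
        intro!: exI[of _ "\<bar>r\<bar> * C"] mult_left_mono)
  fix y assume y: "y \<in> bounded_measurable \<mu>"
  then obtain D where D: "\<And>\<omega>. \<bar>y \<omega>\<bar> \<le> D" by (auto simp: bounded_measurable_def)
  have "\<bar>x \<omega> + y \<omega>\<bar> \<le> C + D" for \<omega>
    using C[of \<omega>] D[of \<omega>] by linarith
  then show "x + y \<in> bounded_measurable \<mu>"
    using x y by (auto simp: bounded_measurable_def plus_fun_def intro!: exI[of _ "C + D"])
qed

lemma indicator_bounded_measurable:
  "B \<in> sets \<mu> \<Longrightarrow> indicator B \<in> bounded_measurable \<mu>"
  using sets.sets_into_space[of B \<mu>]
  by (auto simp: bounded_measurable_def indicator_def intro!: exI[of _ 1])

lemma (in finite_measure) integrable_bounded_measurable_mult: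
  assumes "x \<in> bounded_measurable M" "y \<in> bounded_measurable M"
  shows "integrable M (\<lambda>\<omega>. x \<omega> * y \<omega>)"
proof -
  obtain C D where C: "\<And>\<omega>. \<bar>x \<omega>\<bar> \<le> C" and D: "\<And>\<omega>. \<bar>y \<omega>\<bar> \<le> D"
    using assms by (auto simp: bounded_measurable_def)
  have "\<bar>x \<omega> * y \<omega>\<bar> \<le> C * D" for \<omega>
    unfolding abs_mult using C[of \<omega>] D[of \<omega>] by (intro mult_mono) auto
  then show ?thesis
    using assms by (intro integrable_const_bound[of _ "C * D"]) (auto simp: bounded_measurable_def)
qed

definition pullback :: "'w measure \<Rightarrow> ('w \<Rightarrow> 'w) \<Rightarrow> ('w \<Rightarrow> real) \<Rightarrow> 'w \<Rightarrow> real" where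
  "pullback \<mu> t x = (\<lambda>\<omega>. if \<omega> \<in> space \<mu> then x (t \<omega>) else 0)"

lemma linear_pullback: "linear (pullback \<mu> t)"
  by (rule linearI) (auto simp: pullback_def fun_eq_iff scaleR_fun_def)

lemma pullback_bounded_measurable:
  assumes "t \<in> measurable \<mu> \<mu>" "x \<in> bounded_measurable \<mu>"
  shows "pullback \<mu> t x \<in> bounded_measurable \<mu>"
proof -
  obtain C where C: "\<And>\<omega>. \<bar>x \<omega>\<bar> \<le> C"
    using assms(2) by (auto simp: bounded_measurable_def)
  have "0 \<le> C" using C[of undefined] by linarith
  have "(\<lambda>\<omega>. x (t \<omega>)) \<in> borel_measurable \<mu>"
    using assms by (auto simp: bounded_measurable_def intro: measurable_compose)
  then have "pullback \<mu> t x \<in> borel_measurable \<mu>"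
    unfolding pullback_def by (subst measurable_cong[where g = "\<lambda>\<omega>. x (t \<omega>)"]) auto
  then show ?thesis
    using C \<open>0 \<le> C\<close> by (auto simp: bounded_measurable_def pullback_def intro!: exI[of _ C])
qed

lemma integral_pullback_mult:
  assumes t: "t \<in> measurable \<mu> \<mu>"
    and pres: "\<And>C. C \<in> sets \<mu> \<Longrightarrow> emeasure \<mu> (t -` C \<inter> space \<mu>) = emeasure \<mu> C"
    and x: "x \<in> bounded_measurable \<mu>" and y: "y \<in> bounded_measurable \<mu>"
  shows "(\<integral>\<omega>. pullback \<mu> t x \<omega> * pullback \<mu> t y \<omega> \<partial>\<mu>) = (\<integral>\<omega>. x \<omega> * y \<omega> \<partial>\<mu>)"
proof -
  have [measurable]: "x \<in> borel_measurable \<mu>" "y \<in> borel_measurable \<mu>"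
    using x y by (auto simp: bounded_measurable_def)
  have distr: "distr \<mu> \<mu> t = \<mu>"
    by (rule measure_eqI) (simp_all add: emeasure_distr[OF t] pres)
  have "(\<integral>\<omega>. pullback \<mu> t x \<omega> * pullback \<mu> t y \<omega> \<partial>\<mu>) = (\<integral>\<omega>. x (t \<omega>) * y (t \<omega>) \<partial>\<mu>)"
    by (rule Bochner_Integration.integral_cong) (simp_all add: pullback_def)
  also have "\<dots> = (\<integral>\<omega>. x \<omega> * y \<omega> \<partial>distr \<mu> \<mu> t)"
    by (rule integral_distr[symmetric, OF t]) measurable
  finally show ?thesis unfolding distr .
qed

lemma add_map_affine: "add_map v \<in> affine_semigroup"
  unfolding affine_semigroup_iff add_map_def by (intro exI[of _ 1] exI[of _ v]) simp

lemma mult_map_affine: "u \<noteq> 0 \<Longrightarrow> mult_map u \<in> affine_semigroup"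
  unfolding affine_semigroup_iff mult_map_def by (intro exI[of _ u] exI[of _ 0]) simp

lemma add_map_comp: "add_map v \<circ> add_map u = add_map (u + v)"
  by (simp add: add_map_def fun_eq_iff add.assoc)

lemma mult_map_comp: "mult_map v \<circ> mult_map u = mult_map (u * v)"
  by (simp add: mult_map_def fun_eq_iff mult_ac)

lemma mult_map_add_map: "mult_map u \<circ> add_map v = add_map (u * v) \<circ> mult_map u"
  by (simp add: add_map_def mult_map_def fun_eq_iff distrib_left)

text \<open>This is \<open>recurrence\<close> for the Koopman operators and the indicator of
  \<open>B\<close>: the inner product with the constant one is the measure of \<open>B\<close>, and
  the correlation of the two pullbacks is the measure of the intersection.\<close>

lemma DC_recurrence:
  fixes \<mu> :: "'w measure" and T :: "('a::idom \<Rightarrow> 'a) \<Rightarrow> 'w \<Rightarrow> 'w"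
  assumes R: "large_ideal_domain TYPE('a)" and \<mu>: "prob_space \<mu>"
    and act: "measure_preserving_action \<mu> T"
    and B: "B \<in> sets \<mu>" and \<epsilon>: "\<epsilon> > 0" and p: "p \<in> DC_ultrafilters"
  shows "\<forall>\<^sub>F u in p. u \<noteq> 0 \<and>
    measure \<mu> ((T (add_map u) -` B \<inter> space \<mu>) \<inter> (T (mult_map u) -` B \<inter> space \<mu>))
      \<ge> (measure \<mu> B)\<^sup>2 - \<epsilon>"
proof -
  interpret prob_space \<mu> by fact
  let ?E = "bounded_measurable \<mu>"
  have meas: "T g \<in> measurable \<mu> \<mu>" if "g \<in> affine_semigroup" for g
    using act that by (simp add: measure_preserving_action_def)
  have pres: "emeasure \<mu> (T g -` C \<inter> space \<mu>) = emeasure \<mu> C"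
    if "g \<in> affine_semigroup" "C \<in> sets \<mu>" for g C
    using act that by (simp add: measure_preserving_action_def)
  have comp: "T g (T h \<omega>) = T (g \<circ> h) \<omega>"
    if "g \<in> affine_semigroup" "h \<in> affine_semigroup" "\<omega> \<in> space \<mu>" for g h \<omega>
    using act that by (simp add: measure_preserving_action_def)
  \<comment> \<open>Composing with a linear projection to the bounded measurable functions makes the form and the
    operators total, so that the abstract estimates need no carrier set.\<close>
  obtain \<pi> where \<pi>: "linear \<pi>" "\<And>x. \<pi> x \<in> ?E" "\<And>x. x \<in> ?E \<Longrightarrow> \<pi> x = x"
    using linear_exists_left_inverse_on[OF linear_id subspace_bounded_measurable[of \<mu>]]
    by auto
  define ip where "ip x y = (\<integral>\<omega>. \<pi> x \<omega> * \<pi> y \<omega> \<partial>\<mu>)" for x y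
  define op where "op g x = pullback \<mu> (T g) (\<pi> x)" for g x
  have ip_E: "ip x y = (\<integral>\<omega>. x \<omega> * y \<omega> \<partial>\<mu>)" if "x \<in> ?E" "y \<in> ?E" for x y
    using that by (simp add: ip_def \<pi>(3))
  have op_E: "op g x \<in> ?E" if "g \<in> affine_semigroup" for g x
    unfolding op_def using meas[OF that] \<pi>(2) by (rule pullback_bounded_measurable)
  have op_linear: "linear (op g)" for g
    unfolding op_def using linear_compose[OF \<pi>(1) linear_pullback] by (simp add: o_def)
  have op_iso: "ip (op g x) (op g y) = ip x y" if g: "g \<in> affine_semigroup" for g x y
    unfolding ip_E[OF op_E[OF g] op_E[OF g]] unfolding ip_def op_def
    using meas[OF g] pres[OF g] \<pi>(2) \<pi>(2) by (rule integral_pullback_mult)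
  \<comment> \<open>Pulling back is contravariant; together with \<open>mult_map_add_map\<close>
    this gives the relation \<open>A_M\<close>.\<close>
  have op_comp: "op g (op h x) = op (h \<circ> g) x"
    if g: "g \<in> affine_semigroup" and h: "h \<in> affine_semigroup" for g h x
  proof -
    have "op g (op h x) = pullback \<mu> (T g) (pullback \<mu> (T h) (\<pi> x))"
      using \<pi>(3)[OF op_E[OF h]] by (simp add: op_def)
    also have "\<dots> = pullback \<mu> (T (h \<circ> g)) (\<pi> x)"
      using comp[OF h g] measurable_space[OF meas[OF g]] by (auto simp: pullback_def fun_eq_iff)
    finally show ?thesis by (simp add: op_def)
  qed
  have one_E: "indicator (space \<mu>) \<in> ?E" by (rule indicator_bounded_measurable) simp
  have op_one: "op g (indicator (space \<mu>)) = indicator (space \<mu>)" if "g \<in> affine_semigroup" for g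
    using measurable_space[OF meas[OF that]]
    by (auto simp: op_def \<pi>(3)[OF one_E] pullback_def fun_eq_iff)
  have f_E: "indicator B \<in> ?E" using B by (rule indicator_bounded_measurable)
  interpret affine_isometries_DC ip "\<lambda>u. op (add_map u)" "\<lambda>u. op (mult_map u)" "indicator (space \<mu>)" p
  proof
    note int = integrable_bounded_measurable_mult[OF \<pi>(2) \<pi>(2)]
    show "ip x y = ip y x" for x y by (simp add: ip_def mult.commute)
    show "ip (x + y) z = ip x z + ip y z" for x y z
      using Bochner_Integration.integral_add[OF int[of x z] int[of y z]]
      by (simp add: ip_def linear_add[OF \<pi>(1)] distrib_right)
    show "ip (r *\<^sub>R x) z = r * ip x z" for r x z
      unfolding ip_def linear_scale[OF \<pi>(1)] by (simp add: scaleR_fun_def mult.assoc)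
    show "ip x x \<ge> 0" for x by (simp add: ip_def)
    show "ip (indicator (space \<mu>)) (indicator (space \<mu>)) = 1"
      by (simp add: ip_E[OF one_E one_E] prob_space flip: indicator_inter_arith)
  qed (simp_all add: linear_add[OF op_linear] linear_scale[OF op_linear] op_iso op_comp op_one add_map_affine mult_map_affine
      add_map_comp mult_map_comp mult_map_add_map R p add.commute mult.commute)
  have "ip (indicator B) (indicator B) \<le> 1"
    using B by (simp add: ip_E[OF f_E f_E] flip: indicator_inter_arith)
  then have "nrm (indicator B) \<le> 1" by (simp add: nrm_def)
  from p_neq[of 0] recurrence[OF this \<epsilon>] show ?thesis
  proof eventually_elim
    fix u :: 'a assume u: "u \<noteq> 0" and ineq: "(ip (indicator B) (indicator (space \<mu>)))\<^sup>2 - \<epsilon>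
        \<le> ip (op (add_map u) (indicator B)) (op (mult_map u) (indicator B))"
    let ?S = "(T (add_map u) -` B \<inter> space \<mu>) \<inter> (T (mult_map u) -` B \<inter> space \<mu>)"
    have "?S \<in> sets \<mu>"
      using meas[OF add_map_affine] meas[OF mult_map_affine[OF u]] B
      by (intro sets.Int measurable_sets)
    have "ip (indicator B) (indicator (space \<mu>)) = (\<integral>\<omega>. indicator (B \<inter> space \<mu>) \<omega> \<partial>\<mu>)"
      by (simp add: ip_E[OF f_E one_E] flip: indicator_inter_arith)
    also have "\<dots> = measure \<mu> B" using B by simp
    finally have 1: "ip (indicator B) (indicator (space \<mu>)) = measure \<mu> B" .
    have "ip (op (add_map u) (indicator B)) (op (mult_map u) (indicator B)) =
        (\<integral>\<omega>. indicator ?S \<omega> \<partial>\<mu>)"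
      unfolding ip_E[OF op_E[OF add_map_affine] op_E[OF mult_map_affine[OF u]]]
      by (rule Bochner_Integration.integral_cong)
        (simp_all add: op_def \<pi>(3)[OF f_E] pullback_def indicator_def)
    also have "\<dots> = measure \<mu> ?S" using \<open>?S \<in> sets \<mu>\<close> by simp
    finally show "u \<noteq> 0 \<and> measure \<mu> ?S \<ge> (measure \<mu> B)\<^sup>2 - \<epsilon>" using ineq u 1 by simp
  qed
qed

theorem theorem5p14:
  fixes \<mu> :: "'w measure"
    and T :: "('a::idom \<Rightarrow> 'a) \<Rightarrow> 'w \<Rightarrow> 'w"
    and B :: "'w set"
    and \<epsilon> :: real
  assumes "large_ideal_domain TYPE('a)"
    and "prob_space \<mu>"
    and "measure_preserving_action \<mu> T"
    and "B \<in> sets \<mu>"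
    and "\<epsilon> > 0"
  defines "S \<equiv> {u :: 'a. u \<noteq> 0 \<and>
      measure \<mu> ((T (add_map u) -` B \<inter> space \<mu>) \<inter> (T (mult_map u) -` B \<inter> space \<mu>))
        \<ge> (measure \<mu> B)\<^sup>2 - \<epsilon>}"
  shows "DC_star S \<and> affinely_syndetic S"
proof -
  have "DC_star S"
    unfolding DC_star_iff S_def using DC_recurrence[OF assms(1-5)] by simp
  then show ?thesis using DC_star_imp_affinely_syndetic[OF assms(1)] by blast
qed

end
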